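(* Let $d \in \mathbb{N}$ and let $\phi: \mathbb{B}_d \to \mathbb{B}_d$ and $\delta: \mathbb{B}_d \to \mathbb{C}$ be arbitrary maps. Let $\mathcal{H}$ be a unitarily invariant space on $\mathbb{B}_d$ with $\mathcal{H} \neq \mathcal{H}_\gamma$ for all $\gamma \in (0,\infty)$. Then the following are equivalent: (i) $W_{\delta,\phi}$ is a unitary operator on $\mathcal{H}$; (ii) $W_{\delta,\phi}$ is a co-isometric operator on $\mathcal{H}$; (iii) $\phi$ is (the restriction to $\mathbb{B}_d$ of) a unitary $d \times d$ matrix and $\delta$ is a unimodular constant.
   Context: For $d \in \mathbb{N}$, $\mathbb{B}_d$ is the Euclidean open unit ball of $\mathbb{C}^d$; inner products are linear in the first variable. A unitarily invariant space on $\mathbb{B}_d$ is a reproducing kernel Hilbert space $\mathcal{H}$ of functions on $\mathbb{B}_d$ whose reproducing kernel has the form $K(z,w) = \sum_{n=0}^\infty a_n \langle z,w\rangle^n$ ($z,w \in \mathbb{B}_d$, the series converging there), where $a_0 = 1$, $a_1 > 0$ and $a_n \ge 0$ for all $n \ge 2$. For $\gamma \in (0,\infty)$, $\mathcal{H}_\gamma$ is the reproducing kernel Hilbert space on $\mathbb{B}_d$ with kernel $K(z,w) = (1 - \langle z,w\rangle)^{-\gamma}$ (principal branch). Here $\mathcal{H} \ne \mathcal{H}_\gamma$ means that they differ as reproducing kernel Hilbert spaces, i.e. their reproducing kernels differ. The weighted composition operator $W_{\delta,\phi}$ on $\mathcal{H}$ is $f \mapsto \delta \cdot (f \circ \phi)$.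 Saying that $W_{\delta,\phi}$ is bounded / co-isometric / unitary on $\mathcal{H}$ includes the assertion that it is well defined, i.e. maps $\mathcal{H}$ into $\mathcal{H}$. A bounded operator $T$ is co-isometric if $T^*$ is an isometry ($TT^* = I$). *)

theory Defs
  imports "HOL-Analysis.Analysis"
begin

section \<open>Hilbert spaces of functions\<close>

text \<open>
  A function on a set \<open>X\<close> is represented by a total function that vanishes outside \<open>X\<close>, so that
  equality of functions on \<open>X\<close> is equality in HOL.  Values of the inner product \<open>ip\<close> at
  arguments outside \<open>H\<close> are irrelevant.
\<close>

definition ip_norm :: "('f \<Rightarrow> 'f \<Rightarrow> complex) \<Rightarrow> 'f \<Rightarrow> real" where
  "ip_norm ip f = sqrt (Re (ip f f))"

locale hilbert_function_space =
  fixes X :: "'a set"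
    and H :: "('a \<Rightarrow> complex) set"
    and ip :: "('a \<Rightarrow> complex) \<Rightarrow> ('a \<Rightarrow> complex) \<Rightarrow> complex"
  assumes supported: "\<And>f x. f \<in> H \<Longrightarrow> x \<notin> X \<Longrightarrow> f x = 0"
    and zero_mem: "(\<lambda>x. 0) \<in> H"
    and add_mem: "\<And>f g. f \<in> H \<Longrightarrow> g \<in> H \<Longrightarrow> (\<lambda>x. f x + g x) \<in> H"
    and scale_mem: "\<And>c f. f \<in> H \<Longrightarrow> (\<lambda>x. c * f x) \<in> H"
    and ip_add_left: "\<And>f g h. f \<in> H \<Longrightarrow> g \<in> H \<Longrightarrow> h \<in> H \<Longrightarrow>
          ip (\<lambda>x. f x + g x) h = ip f h + ip g h"
    and ip_scale_left: "\<And>c f g. f \<in> H \<Longrightarrow> g \<in> H \<Longrightarrow> ip (\<lambda>x. c * f x) g = c * ip f g"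
    and ip_commute: "\<And>f g. f \<in> H \<Longrightarrow> g \<in> H \<Longrightarrow> ip g f = cnj (ip f g)"
    and ip_nonneg: "\<And>f. f \<in> H \<Longrightarrow> 0 \<le> Re (ip f f)"
    and ip_definite: "\<And>f. f \<in> H \<Longrightarrow> ip f f = 0 \<Longrightarrow> f = (\<lambda>x. 0)"
    and complete: "\<And>F :: nat \<Rightarrow> 'a \<Rightarrow> complex.
          (\<And>n. F n \<in> H) \<Longrightarrow>
          (\<And>e. e > 0 \<Longrightarrow> \<exists>N. \<forall>m\<ge>N. \<forall>n\<ge>N. ip_norm ip (\<lambda>x. F m x - F n x) < e) \<Longrightarrow>
          \<exists>f\<in>H. (\<lambda>n. ip_norm ip (\<lambda>x. F n x - f x)) \<longlonglongrightarrow> 0"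

definition kernel_fun :: "'a set \<Rightarrow> ('a \<Rightarrow> 'a \<Rightarrow> complex) \<Rightarrow> 'a \<Rightarrow> 'a \<Rightarrow> complex" where
  "kernel_fun X K w = (\<lambda>z. if z \<in> X then K z w else 0)"

text \<open>Only the values of \<open>K\<close> on \<open>X \<times> X\<close> matter; there they are determined by \<open>(H, ip)\<close>.\<close>

locale rkhs = hilbert_function_space X H ip
  for X :: "'a set"
    and H :: "('a \<Rightarrow> complex) set"
    and ip :: "('a \<Rightarrow> complex) \<Rightarrow> ('a \<Rightarrow> complex) \<Rightarrow> complex" +
  fixes K :: "'a \<Rightarrow> 'a \<Rightarrow> complex"
  assumes kernel_mem: "\<And>w. w \<in> X \<Longrightarrow> kernel_fun X K w \<in> H"
    and reproducing: "\<And>f w. f \<in> H \<Longrightarrow> w \<in> X \<Longrightarrow> f w = ip f (kernel_fun X K w)"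


section \<open>Operators\<close>

definition bounded_operator ::
    "('a \<Rightarrow> complex) set \<Rightarrow> (('a \<Rightarrow> complex) \<Rightarrow> ('a \<Rightarrow> complex) \<Rightarrow> complex) \<Rightarrow>
     (('a \<Rightarrow> complex) \<Rightarrow> ('a \<Rightarrow> complex)) \<Rightarrow> bool" where
  "bounded_operator H ip T \<longleftrightarrow>
     (\<forall>f\<in>H. T f \<in> H) \<and>
     (\<forall>f\<in>H. \<forall>g\<in>H. T (\<lambda>x. f x + g x) = (\<lambda>x. T f x + T g x)) \<and>
     (\<forall>c. \<forall>f\<in>H. T (\<lambda>x. c * f x) = (\<lambda>x. c * T f x)) \<and>
     (\<exists>C. \<forall>f\<in>H. ip_norm ip (T f) \<le> C * ip_norm ip f)"

text \<open>
  For a bounded operator on a Hilbert space the description below determines a unique element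
  of \<open>H\<close>, by the Riesz representation theorem.
\<close>

definition hilbert_adjoint ::
    "('a \<Rightarrow> complex) set \<Rightarrow> (('a \<Rightarrow> complex) \<Rightarrow> ('a \<Rightarrow> complex) \<Rightarrow> complex) \<Rightarrow>
     (('a \<Rightarrow> complex) \<Rightarrow> ('a \<Rightarrow> complex)) \<Rightarrow> ('a \<Rightarrow> complex) \<Rightarrow> ('a \<Rightarrow> complex)" where
  "hilbert_adjoint H ip T g = (THE h. h \<in> H \<and> (\<forall>f\<in>H. ip (T f) g = ip f h))"

definition isometric_operator ::
    "('a \<Rightarrow> complex) set \<Rightarrow> (('a \<Rightarrow> complex) \<Rightarrow> ('a \<Rightarrow> complex) \<Rightarrow> complex) \<Rightarrow>
     (('a \<Rightarrow> complex) \<Rightarrow> ('a \<Rightarrow> complex)) \<Rightarrow> bool" where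
  "isometric_operator H ip T \<longleftrightarrow>
     bounded_operator H ip T \<and> (\<forall>f\<in>H. ip_norm ip (T f) = ip_norm ip f)"

definition coisometric_operator ::
    "('a \<Rightarrow> complex) set \<Rightarrow> (('a \<Rightarrow> complex) \<Rightarrow> ('a \<Rightarrow> complex) \<Rightarrow> complex) \<Rightarrow>
     (('a \<Rightarrow> complex) \<Rightarrow> ('a \<Rightarrow> complex)) \<Rightarrow> bool" where
  "coisometric_operator H ip T \<longleftrightarrow>
     bounded_operator H ip T \<and> isometric_operator H ip (hilbert_adjoint H ip T)"

definition unitary_operator ::
    "('a \<Rightarrow> complex) set \<Rightarrow> (('a \<Rightarrow> complex) \<Rightarrow> ('a \<Rightarrow> complex) \<Rightarrow> complex) \<Rightarrow>
     (('a \<Rightarrow> complex) \<Rightarrow> ('a \<Rightarrow> complex)) \<Rightarrow> bool" where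
  "unitary_operator H ip T \<longleftrightarrow>
     bounded_operator H ip T \<and>
     (\<forall>f\<in>H. hilbert_adjoint H ip T (T f) = f) \<and>
     (\<forall>f\<in>H. T (hilbert_adjoint H ip T f) = f)"

definition weighted_comp ::
    "'a set \<Rightarrow> ('a \<Rightarrow> complex) \<Rightarrow> ('a \<Rightarrow> 'a) \<Rightarrow> ('a \<Rightarrow> complex) \<Rightarrow> ('a \<Rightarrow> complex)" where
  "weighted_comp X \<delta> \<phi> f = (\<lambda>z. if z \<in> X then \<delta> z * f (\<phi> z) else 0)"


section \<open>Unitarily invariant spaces on the ball\<close>

text \<open>The library's \<open>inner\<close> on \<open>complex ^ 'd\<close> is the real part of this; both induce the same norm.\<close>

definition cinner :: "complex ^ 'd \<Rightarrow> complex ^ 'd \<Rightarrow> complex" where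
  "cinner z w = (\<Sum>i\<in>UNIV. z $ i * cnj (w $ i))"

abbreviation unit_ball :: "(complex ^ 'd) set" where
  "unit_ball \<equiv> ball 0 1"

definition unitarily_invariant_space ::
    "(complex ^ 'd \<Rightarrow> complex) set \<Rightarrow>
     ((complex ^ 'd \<Rightarrow> complex) \<Rightarrow> (complex ^ 'd \<Rightarrow> complex) \<Rightarrow> complex) \<Rightarrow> bool" where
  "unitarily_invariant_space H ip \<longleftrightarrow>
     (\<exists>K (a :: nat \<Rightarrow> real).
        rkhs unit_ball H ip K \<and>
        a 0 = 1 \<and> a 1 > 0 \<and> (\<forall>n\<ge>2. a n \<ge> 0) \<and>
        (\<forall>z\<in>unit_ball. \<forall>w\<in>unit_ball. (\<lambda>n. of_real (a n) * cinner z w ^ n) sums K z w))"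

definition gamma_kernel :: "real \<Rightarrow> complex ^ 'd \<Rightarrow> complex ^ 'd \<Rightarrow> complex" where
  "gamma_kernel \<gamma> z w = (1 - cinner z w) powr (- complex_of_real \<gamma>)"

definition unitary_matrix :: "complex ^ 'd ^ 'd \<Rightarrow> bool" where
  "unitary_matrix U \<longleftrightarrow>
     (let U' = (\<chi> i j. cnj (U $ j $ i)) in U' ** U = mat 1 \<and> U ** U' = mat 1)"

end

theory Submission
  imports Defs "HOL-Complex_Analysis.Complex_Analysis"
begin

text \<open>
  Write \<open>K(z,w) = f(\<langle>z,w\<rangle>)\<close>.  The adjoint of a weighted composition operator maps \<open>K(\<cdot>,w)\<close> to
  \<open>cnj (\<delta> w) K(\<cdot>,\<phi> w)\<close>, so a co-isometric or unitary one satisfies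
  \<open>f(\<langle>z,w\<rangle>) = \<delta> z cnj (\<delta> w) f(\<langle>\<phi> z,\<phi> w\<rangle>)\<close>.  Since elements of \<open>H\<close> are holomorphic on complex lines through
  the origin, so are \<open>\<delta>\<close> and \<open>\<phi>\<close>, and the identity can be differentiated.  If \<open>\<phi> 0 = 0\<close>, its
  first-order part shows that \<open>\<phi>\<close> is linear and preserves inner products.  If \<open>b = \<phi> 0 \<noteq> 0\<close>, the
  first-order part shows that \<open>\<phi>\<close> maps some disc through \<open>0\<close> into the line spanned by \<open>b\<close>.  The
  resulting one-variable identity, differentiated twice, makes \<open>x u'\<close> a quadratic polynomial in
  \<open>u = x f'/f\<close>, whence \<open>f' (1 - c x) = a\<^sub>1 f\<close> for some \<open>c\<close>.  Then \<open>\<phi>\<close> acts on the disc as a Moebius map,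
  which maps it into the unit disc only if \<open>c = 1\<close>, and \<open>H\<close> is \<open>H\<^sub>\<gamma>\<close> with \<open>\<gamma> = a\<^sub>1\<close>.
\<close>

section \<open>Reproducing kernel Hilbert spaces\<close>

context hilbert_function_space
begin

abbreviation nrm :: "('a \<Rightarrow> complex) \<Rightarrow> real" where "nrm \<equiv> ip_norm ip"

lemma uminus_mem: "f \<in> H \<Longrightarrow> (\<lambda>x. - f x) \<in> H"
  using scale_mem[of f "-1"] by simp

lemma diff_mem: "f \<in> H \<Longrightarrow> g \<in> H \<Longrightarrow> (\<lambda>x. f x - g x) \<in> H"
  using add_mem[OF _ uminus_mem[of g], of f] by simp

lemma ip_diff_left:
  assumes "f \<in> H" "g \<in> H" "h \<in> H"
  shows "ip (\<lambda>x. f x - g x) h = ip f h - ip g h"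
  using ip_add_left[OF assms(1) uminus_mem[OF assms(2)] assms(3)]
    ip_scale_left[OF assms(2,3), of "-1"] by simp

lemma ip_add_right:
  assumes "f \<in> H" "g \<in> H" "h \<in> H"
  shows "ip h (\<lambda>x. f x + g x) = ip h f + ip h g"
  using assms by (simp add: ip_commute[of _ h] add_mem ip_add_left)

lemma ip_diff_right:
  assumes "f \<in> H" "g \<in> H" "h \<in> H"
  shows "ip h (\<lambda>x. f x - g x) = ip h f - ip h g"
  using assms by (simp add: ip_commute[of _ h] diff_mem ip_diff_left)

lemma ip_scale_right:
  assumes "f \<in> H" "h \<in> H"
  shows "ip h (\<lambda>x. c * f x) = cnj c * ip h f"
  using assms by (simp add: ip_commute[of _ h] scale_mem ip_scale_left)

lemma nrm_nonneg: "f \<in> H \<Longrightarrow> 0 \<le> nrm f"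
  by (simp add: ip_norm_def ip_nonneg)

lemma ip_self: "f \<in> H \<Longrightarrow> ip f f = of_real ((nrm f)\<^sup>2)"
  using ip_commute[of f f] ip_nonneg[of f]
  by (simp add: ip_norm_def complex_eq_iff)

lemma nrm_eq_0D: "f \<in> H \<Longrightarrow> nrm f = 0 \<Longrightarrow> f = (\<lambda>x. 0)"
  using ip_definite[of f] ip_self[of f] by simp

lemma nrm_scale: "f \<in> H \<Longrightarrow> nrm (\<lambda>x. c * f x) = cmod c * nrm f"
proof -
  assume f: "f \<in> H"
  have "ip (\<lambda>x. c * f x) (\<lambda>x. c * f x) = (c * cnj c) * ip f f"
    using f by (simp add: ip_scale_left ip_scale_right scale_mem)
  also have "\<dots> = of_real ((cmod c * nrm f)\<^sup>2)"
    using f by (simp add: ip_self complex_norm_square[symmetric] power_mult_distrib)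
  finally show ?thesis
    using nrm_nonneg[OF f] by (simp add: ip_norm_def[of ip "\<lambda>x. c * f x"])
qed

lemma nrm_sq_add:
  assumes "f \<in> H" "g \<in> H"
  shows "(nrm (\<lambda>x. f x + g x))\<^sup>2 = (nrm f)\<^sup>2 + 2 * Re (ip f g) + (nrm g)\<^sup>2"
proof -
  have "of_real ((nrm (\<lambda>x. f x + g x))\<^sup>2) = ip f f + (ip f g + cnj (ip f g)) + ip g g"
    using assms ip_commute[of f g] ip_self[of "\<lambda>x. f x + g x"]
    by (simp add: add_mem ip_add_left ip_add_right add.assoc)
  also have "\<dots> = of_real ((nrm f)\<^sup>2 + 2 * Re (ip f g) + (nrm g)\<^sup>2)"
    using assms by (simp add: ip_self complex_add_cnj)
  finally show ?thesis by (simp only: of_real_eq_iff)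
qed

lemma nrm_sq_diff:
  assumes "f \<in> H" "g \<in> H"
  shows "(nrm (\<lambda>x. f x - g x))\<^sup>2 = (nrm f)\<^sup>2 - 2 * Re (ip f g) + (nrm g)\<^sup>2"
  using nrm_sq_add[OF assms(1) uminus_mem[OF assms(2)]] nrm_scale[OF assms(2), of "-1"]
    ip_scale_right[OF assms(2,1), of "-1"] by simp

text \<open>Parallelogram law with one square dropped. It plays the role of the triangle inequality
  in Cauchy arguments.\<close>

lemma nrm_sq_diff_le:
  assumes "f \<in> H" "g \<in> H"
  shows "(nrm (\<lambda>x. f x - g x))\<^sup>2 \<le> 2 * (nrm f)\<^sup>2 + 2 * (nrm g)\<^sup>2"
  using nrm_sq_add[OF assms] nrm_sq_diff[OF assms] by (smt (verit) zero_le_power2)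

lemma Cauchy_Schwarz:
  assumes f: "f \<in> H" and g: "g \<in> H"
  shows "cmod (ip f g) \<le> nrm f * nrm g"
proof (cases "nrm g = 0")
  case True
  then have "g = (\<lambda>x. 0)" using g nrm_eq_0D by blast
  then have "ip f g = 0" using ip_scale_right[OF g f, of 0] by simp
  then show ?thesis using True by simp
next
  case False
  \<comment> \<open>The coefficient of the orthogonal projection of \<open>f\<close> onto
    \<open>g\<close>; the squared norm of the remainder is nonnegative, which is the
    inequality.\<close>
  define c where "c = ip f g / of_real ((nrm g)\<^sup>2)"
  have "0 \<le> (nrm (\<lambda>x. f x - c * g x))\<^sup>2" by simp
  also have "\<dots> = (nrm f)\<^sup>2 - 2 * Re (cnj c * ip f g) + (cmod c * nrm g)\<^sup>2"
    using nrm_sq_diff[OF f scale_mem[OF g]] nrm_scale[OF g] ip_scale_right[OF g f] by simp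
  also have "cnj c * ip f g = of_real ((cmod (ip f g))\<^sup>2 / (nrm g)\<^sup>2)"
    using complex_norm_square[of "ip f g"] by (simp add: c_def mult.commute)
  also have "(cmod c * nrm g)\<^sup>2 = (cmod (ip f g))\<^sup>2 / (nrm g)\<^sup>2"
    unfolding c_def norm_divide norm_of_real using False
    by (simp add: power2_eq_square)
  finally have "(cmod (ip f g))\<^sup>2 / (nrm g)\<^sup>2 \<le> (nrm f)\<^sup>2" by simp
  then have "(cmod (ip f g))\<^sup>2 \<le> (nrm f * nrm g)\<^sup>2"
    using False by (simp add: divide_le_eq power_mult_distrib)
  then show ?thesis by (rule power2_le_imp_le) (simp add: nrm_nonneg f g)
qed

lemma ip_tendsto_left:
  assumes F: "\<And>n. F n \<in> H" and f: "f \<in> H" and g: "g \<in> H"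
    and lim: "(\<lambda>n. nrm (\<lambda>x. F n x - f x)) \<longlonglongrightarrow> 0"
  shows "(\<lambda>n. ip (F n) g) \<longlonglongrightarrow> ip f g"
proof (rule LIM_zero_cancel, rule Lim_null_comparison)
  show "\<forall>\<^sub>F n in sequentially. norm (ip (F n) g - ip f g) \<le> nrm (\<lambda>x. F n x - f x) * nrm g"
    using Cauchy_Schwarz[OF diff_mem[OF F f] g] F f g by (simp add: ip_diff_left)
  show "(\<lambda>n. nrm (\<lambda>x. F n x - f x) * nrm g) \<longlonglongrightarrow> 0"
    using tendsto_mult_right[OF lim, of "nrm g"] by simp
qed

lemma Cauchy_if_convergent:
  assumes F: "\<And>n. F n \<in> H" and f: "f \<in> H"
    and lim: "(\<lambda>n. nrm (\<lambda>x. F n x - f x)) \<longlonglongrightarrow> 0" and e: "e > 0"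
  shows "\<exists>N. \<forall>m\<ge>N. \<forall>n\<ge>N. nrm (\<lambda>x. F m x - F n x) < e"
proof -
  obtain N where N: "\<And>n. n \<ge> N \<Longrightarrow> nrm (\<lambda>x. F n x - f x) < e / 2"
    using LIMSEQ_D[OF lim, of "e / 2"] e by fastforce
  have "nrm (\<lambda>x. F m x - F n x) < e" if "m \<ge> N" "n \<ge> N" for m n
  proof -
    have "(nrm (\<lambda>x. F m x - F n x))\<^sup>2 \<le> 2 * (nrm (\<lambda>x. F m x - f x))\<^sup>2 + 2 * (nrm (\<lambda>x. F n x - f x))\<^sup>2"
      using nrm_sq_diff_le[OF diff_mem[OF F f] diff_mem[OF F f], of m n] by simp
    also have "\<dots> < 2 * (e / 2)\<^sup>2 + 2 * (e / 2)\<^sup>2"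
      using N that nrm_nonneg[OF diff_mem[OF F f]]
      by (intro add_strict_mono mult_strict_left_mono power_strict_mono) auto
    also have "\<dots> = e\<^sup>2" by (simp add: power2_eq_square)
    finally show ?thesis using e by (simp add: power_less_imp_less_base)
  qed
  then show ?thesis by blast
qed

text \<open>Polarization: comparing \<open>nrm_sq_add\<close> for a pair and for its image gives
  equal real parts of the inner products, and scaling the first vector by \<open>-\<i>\<close> turns
  imaginary parts into real parts.\<close>

lemma isometry_ip:
  assumes T: "\<And>f. f \<in> H \<Longrightarrow> T f \<in> H"
    and add: "\<And>f g. f \<in> H \<Longrightarrow> g \<in> H \<Longrightarrow> T (\<lambda>x. f x + g x) = (\<lambda>x. T f x + T g x)"
    and scale: "\<And>c f. f \<in> H \<Longrightarrow> T (\<lambda>x. c * f x) = (\<lambda>x. c * T f x)"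
    and iso: "\<And>f. f \<in> H \<Longrightarrow> nrm (T f) = nrm f"
    and f: "f \<in> H" and g: "g \<in> H"
  shows "ip (T f) (T g) = ip f g"
proof -
  have Re: "Re (ip (T u) (T v)) = Re (ip u v)" if "u \<in> H" "v \<in> H" for u v
    using nrm_sq_add[OF that] nrm_sq_add[OF T T, OF that] iso[OF add_mem[OF that]]
      iso[OF that(1)] iso[OF that(2)] add[OF that] by simp
  have "Im (ip (T f) (T g)) = Im (ip f g)"
    using Re[OF scale_mem[OF f, of "-\<i>"] g] ip_scale_left[OF f g, of "-\<i>"]
      ip_scale_left[OF T T, OF f g, of "-\<i>"] scale[OF f, of "-\<i>"] by simp
  then show ?thesis using Re[OF f g] by (simp add: complex_eq_iff)
qed

text \<open>The difference of two vectors representing the same functional is orthogonal to itself,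
  so any representing vector is the one selected by \<open>THE\<close>. This computes the adjoint at
  a single vector \<open>g\<close>.\<close>

lemma hilbert_adjoint_eqI:
  assumes h: "h \<in> H" and T: "\<And>f. f \<in> H \<Longrightarrow> T f \<in> H"
    and eq: "\<And>f. f \<in> H \<Longrightarrow> ip (T f) g = ip f h"
  shows "hilbert_adjoint H ip T g = h"
  unfolding hilbert_adjoint_def
proof (rule the_equality)
  show "h \<in> H \<and> (\<forall>f\<in>H. ip (T f) g = ip f h)" using h eq by blast
  fix k assume k: "k \<in> H \<and> (\<forall>f\<in>H. ip (T f) g = ip f k)"
  have d: "(\<lambda>x. k x - h x) \<in> H" using k h diff_mem by blast
  have "ip (\<lambda>x. k x - h x) (\<lambda>x. k x - h x) = 0"
    using k h eq[OF d] d ip_diff_right[OF _ h d, of k] by auto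
  then have "(\<lambda>x. k x - h x) = (\<lambda>x. 0)" using d ip_definite by blast
  then show "k = h" by (simp add: fun_eq_iff)
qed

end

section \<open>Kernel functions and closed subspaces\<close>

context rkhs
begin

abbreviation ker :: "'a \<Rightarrow> 'a \<Rightarrow> complex" where "ker \<equiv> kernel_fun X K"

lemma ip_ker_ker: "z \<in> X \<Longrightarrow> w \<in> X \<Longrightarrow> ip (ker w) (ker z) = K z w"
  using reproducing[OF kernel_mem] by (simp add: kernel_fun_def)

lemma point_eval_le: "f \<in> H \<Longrightarrow> w \<in> X \<Longrightarrow> cmod (f w) \<le> nrm f * nrm (ker w)"
  using Cauchy_Schwarz[of f "ker w"] kernel_mem reproducing[of f w] by simp

lemma pointwise_limit:
  assumes "\<And>n. F n \<in> H" "f \<in> H" "(\<lambda>n. nrm (\<lambda>x. F n x - f x)) \<longlonglongrightarrow> 0"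
  shows "(\<lambda>n. F n x) \<longlonglongrightarrow> f x"
proof (cases "x \<in> X")
  case True
  then show ?thesis
    using ip_tendsto_left[OF assms(1,2) kernel_mem[OF True] assms(3)]
      reproducing[OF assms(1) True] reproducing[OF assms(2) True] by simp
next
  case False
  then show ?thesis using supported[OF assms(1) False] supported[OF assms(2) False] by simp
qed

text \<open>Orthogonal projection: a sequence in \<open>S\<close> minimizing the distance to
  \<open>f\<close> is Cauchy, and its limit \<open>g\<close> lies in \<open>S\<close>. Minimality
  makes \<open>f - g\<close> orthogonal to every kernel function, that is, zero at every point. The
  lemma serves as an induction principle: a linear property that holds for kernel functions and
  survives norm limits holds on all of \<open>H\<close>.\<close>

lemma closed_subspace_eq:
  assumes SH: "S \<subseteq> H" and zero: "(\<lambda>x. 0) \<in> S"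
    and add: "\<And>f g. f \<in> S \<Longrightarrow> g \<in> S \<Longrightarrow> (\<lambda>x. f x + g x) \<in> S"
    and scale: "\<And>c f. f \<in> S \<Longrightarrow> (\<lambda>x. c * f x) \<in> S"
    and ker: "\<And>w. w \<in> X \<Longrightarrow> ker w \<in> S"
    and closed: "\<And>F f. (\<And>n. F n \<in> S) \<Longrightarrow> f \<in> H \<Longrightarrow>
          (\<lambda>n. nrm (\<lambda>x. F n x - f x)) \<longlonglongrightarrow> 0 \<Longrightarrow> f \<in> S"
  shows "S = H"
proof (intro equalityI SH subsetI)
  fix f assume f: "f \<in> H"
  define D where "D = (\<lambda>g. (nrm (\<lambda>x. f x - g x))\<^sup>2) ` S"
  have D0: "bdd_below D" unfolding D_def by (rule bdd_belowI[of _ 0]) auto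
  have "D \<noteq> {}" using zero D_def by auto
  then have "\<exists>g\<in>S. (nrm (\<lambda>x. f x - g x))\<^sup>2 < Inf D + 1 / Suc n" for n
    using cInf_lessD[of D "Inf D + 1 / Suc n"] by (auto simp: D_def)
  then obtain F where FS: "\<And>n. F n \<in> S" and F: "\<And>n. (nrm (\<lambda>x. f x - F n x))\<^sup>2 < Inf D + 1 / Suc n"
    by metis
  have FH: "F n \<in> H" for n using FS SH by blast
  have low: "Inf D \<le> (nrm (\<lambda>x. f x - g x))\<^sup>2" if "g \<in> S" for g
    using that D0 by (auto simp: D_def intro!: cInf_lower)
  \<comment> \<open>Parallelogram law for \<open>?u\<close> and \<open>?v\<close>; the midpoint
    \<open>?g\<close> lies in \<open>S\<close>, so its squared distance to \<open>f\<close> is at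
    least \<open>Inf D\<close>.\<close>
  have par: "(nrm (\<lambda>x. F m x - F n x))\<^sup>2 < 2 * (1 / Suc m + 1 / Suc n)" for m n
  proof -
    let ?u = "\<lambda>x. f x - F m x" and ?v = "\<lambda>x. f x - F n x"
    let ?g = "\<lambda>x. (1/2) * (F m x + F n x)"
    have u: "?u \<in> H" and v: "?v \<in> H" using f FH diff_mem by auto
    have g: "?g \<in> S" using scale add FS by blast
    have gH: "(\<lambda>x. f x - ?g x) \<in> H" using f g SH diff_mem by blast
    have eq1: "(\<lambda>x. ?u x - ?v x) = (\<lambda>x. - 1 * (F m x - F n x))" by auto
    have eq2: "(\<lambda>x. ?u x + ?v x) = (\<lambda>x. 2 * (f x - ?g x))" by (auto simp: algebra_simps)
    have "(nrm (\<lambda>x. F m x - F n x))\<^sup>2 + 4 * (nrm (\<lambda>x. f x - ?g x))\<^sup>2 = 2 * (nrm ?u)\<^sup>2 + 2 * (nrm ?v)\<^sup>2"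
      using nrm_sq_diff[OF u v] nrm_sq_add[OF u v] nrm_scale[OF gH, of 2]
        nrm_scale[OF diff_mem[OF FH FH], of "- 1" m n] unfolding eq1 eq2
      by (simp add: power_mult_distrib)
    moreover have "A < 2 * (p + q)"
      if "A + 4 * B = 2 * U + 2 * V" "d \<le> B" "U < d + p" "V < d + q" for A B U V d p q :: real
      using that by (smt (verit))
    ultimately show ?thesis using low[OF g] F[of m] F[of n] by blast
  qed
  have "\<exists>N. \<forall>m\<ge>N. \<forall>n\<ge>N. nrm (\<lambda>x. F m x - F n x) < e" if e: "e > 0" for e
  proof -
    obtain N where N: "1 / Suc N < e\<^sup>2 / 4" using e nat_approx_posE[of "e\<^sup>2 / 4"] by auto
    have "nrm (\<lambda>x. F m x - F n x) < e" if "m \<ge> N" "n \<ge> N" for m n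
    proof -
      have "1 / Suc m \<le> 1 / Suc N" "1 / Suc n \<le> 1 / Suc N"
        using that by (auto intro!: divide_left_mono)
      then have "2 * (1 / Suc m + 1 / Suc n) \<le> 2 * (1 / Suc N + 1 / Suc N)"
        by (intro mult_left_mono add_mono) auto
      also have "\<dots> < e\<^sup>2" using N by (simp only: pos_less_divide_eq) simp
      finally have "(nrm (\<lambda>x. F m x - F n x))\<^sup>2 < e\<^sup>2"
        by (rule less_trans[OF par])
      then show ?thesis using e by (simp add: power_less_imp_less_base)
    qed
    then show ?thesis by blast
  qed
  then obtain g where g: "g \<in> H" and lim: "(\<lambda>n. nrm (\<lambda>x. F n x - g x)) \<longlonglongrightarrow> 0"
    using complete[of F] FH by blast
  have gS: "g \<in> S" using closed[OF FS g lim] .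
  have "f w - g w = 0" if w: "w \<in> X" for w
  proof -
    let ?k = "ker w"
    have kH: "?k \<in> H" and kS: "?k \<in> S" using kernel_mem w ker by auto
    define L where "L n = f w - F n w" for n
    define M where "M = (nrm ?k)\<^sup>2"
    have Llim: "L \<longlonglongrightarrow> f w - g w" unfolding L_def
      using pointwise_limit[OF FH g lim] by (intro tendsto_intros)
    \<comment> \<open>Moving \<open>F n\<close> by \<open>c * ker w\<close> stays in
      \<open>S\<close> and cannot bring the squared distance below \<open>Inf D\<close>.\<close>
    have "2 * Re (cnj c * L n) \<le> (cmod c)\<^sup>2 * M + 1 / Suc n" for c n
    proof -
      have fF: "(\<lambda>x. f x - F n x) \<in> H" using f FH diff_mem by blast
      have "Inf D \<le> (nrm (\<lambda>x. f x - (F n x + c * ?k x)))\<^sup>2"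
        using low[OF add[OF FS scale[OF kS]]] .
      also have "\<dots> = (nrm (\<lambda>x. (f x - F n x) - c * ?k x))\<^sup>2" by (simp add: algebra_simps)
      also have "\<dots> = (nrm (\<lambda>x. f x - F n x))\<^sup>2 - 2 * Re (cnj c * L n) + (cmod c)\<^sup>2 * M"
        using nrm_sq_diff[OF fF scale_mem[OF kH]] ip_scale_right[OF kH fF] nrm_scale[OF kH]
          reproducing[OF fF w] by (simp add: L_def M_def power_mult_distrib)
      finally show ?thesis using F[of n] by linarith
    qed
    moreover have "(\<lambda>n. 2 * Re (cnj c * L n)) \<longlonglongrightarrow> 2 * Re (cnj c * (f w - g w))" for c
      by (intro tendsto_intros Llim)
    moreover have "(\<lambda>n. (cmod c)\<^sup>2 * M + 1 / Suc n) \<longlonglongrightarrow> (cmod c)\<^sup>2 * M" for c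
      using tendsto_add[OF tendsto_const LIMSEQ_inverse_real_of_nat, of "(cmod c)\<^sup>2 * M"]
      by (simp add: inverse_eq_divide)
    ultimately have key: "2 * Re (cnj c * (f w - g w)) \<le> (cmod c)\<^sup>2 * M" for c
      by (meson LIMSEQ_le)
    let ?l = "f w - g w"
    have M: "M \<ge> 0" by (simp add: M_def)
    \<comment> \<open>The choice \<open>c = ?l / (M + 1)\<close> in \<open>key\<close> forces
      \<open>?l = 0\<close>. Adding 1 keeps the denominator positive even if the kernel function at
      \<open>w\<close> is zero.\<close>
    have "2 * Re (cnj (of_real (1 / (M + 1)) * ?l) * ?l) = 2 * (1 / (M + 1)) * (cmod ?l)\<^sup>2"
    proof -
      have "Re (cnj (of_real t * l) * l) = t * (cmod l)\<^sup>2" for t l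
        unfolding cmod_power2 by (simp add: algebra_simps power2_eq_square)
      then show ?thesis by (simp only: mult.assoc)
    qed
    moreover have "(cmod (of_real (1 / (M + 1)) * ?l))\<^sup>2 * M = (1 / (M + 1)) * (M / (M + 1)) * (cmod ?l)\<^sup>2"
      using M by (simp add: norm_mult norm_divide power_mult_distrib power2_eq_square)
    ultimately have "2 * (1 / (M + 1)) * (cmod ?l)\<^sup>2 \<le> (1 / (M + 1)) * (M / (M + 1)) * (cmod ?l)\<^sup>2"
      using key[of "of_real (1 / (M + 1)) * ?l"] by linarith
    then have "(1 / (M + 1)) * (2 * (cmod ?l)\<^sup>2) \<le> (1 / (M + 1)) * (M / (M + 1) * (cmod ?l)\<^sup>2)"
      by (simp only: mult_ac)
    then have "2 * (cmod ?l)\<^sup>2 \<le> M / (M + 1) * (cmod ?l)\<^sup>2"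
      by (rule mult_left_le_imp_le) (use M in simp)
    also have "\<dots> \<le> 1 * (cmod ?l)\<^sup>2" using M by (intro mult_right_mono) auto
    finally show ?thesis by simp
  qed
  then have "f = g" using supported f g by (metis eq_iff_diff_eq_0 ext)
  then show "f \<in> S" using gS by simp
qed

section \<open>Weighted composition operators and the kernel identity\<close>

lemma adjoint_weighted_comp_ker:
  assumes phi: "\<phi> \<in> X \<rightarrow> X" and W: "\<And>f. f \<in> H \<Longrightarrow> weighted_comp X \<delta> \<phi> f \<in> H" and w: "w \<in> X"
  shows "hilbert_adjoint H ip (weighted_comp X \<delta> \<phi>) (ker w) = (\<lambda>x. cnj (\<delta> w) * ker (\<phi> w) x)"
proof (rule hilbert_adjoint_eqI)
  have pw: "\<phi> w \<in> X" using phi w by blast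
  show "(\<lambda>x. cnj (\<delta> w) * ker (\<phi> w) x) \<in> H" using kernel_mem[OF pw] scale_mem by blast
  show "ip (weighted_comp X \<delta> \<phi> f) (ker w) = ip f (\<lambda>x. cnj (\<delta> w) * ker (\<phi> w) x)" if f: "f \<in> H" for f
    using reproducing[OF W[OF f] w] reproducing[OF f pw] w ip_scale_right[OF kernel_mem[OF pw] f]
    by (simp add: weighted_comp_def)
qed (rule W)

text \<open>The isometric adjoint preserves the inner product of \<open>ker w\<close> and
  \<open>ker z\<close>, and both images are known multiples of kernel functions.\<close>

lemma coisometric_kernel_eq:
  assumes phi: "\<phi> \<in> X \<rightarrow> X" and co: "coisometric_operator H ip (weighted_comp X \<delta> \<phi>)"
    and z: "z \<in> X" and w: "w \<in> X"
  shows "K z w = \<delta> z * cnj (\<delta> w) * K (\<phi> z) (\<phi> w)"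
proof -
  let ?T = "hilbert_adjoint H ip (weighted_comp X \<delta> \<phi>)"
  have W: "\<And>f. f \<in> H \<Longrightarrow> weighted_comp X \<delta> \<phi> f \<in> H" and T: "isometric_operator H ip ?T"
    using co by (auto simp: coisometric_operator_def bounded_operator_def)
  have p: "\<phi> z \<in> X" "\<phi> w \<in> X" using phi z w by auto
  have "K z w = ip (?T (ker w)) (?T (ker z))"
    using isometry_ip[of ?T "ker w" "ker z"] T kernel_mem z w ip_ker_ker[OF z w]
    by (simp add: isometric_operator_def bounded_operator_def)
  also have "\<dots> = \<delta> z * cnj (\<delta> w) * K (\<phi> z) (\<phi> w)"
    using kernel_mem p
    by (simp add: adjoint_weighted_comp_ker[OF phi W] z w ip_scale_left ip_scale_right scale_mem ip_ker_ker)
  finally show ?thesis .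
qed

text \<open>The operator composed with its adjoint fixes \<open>ker w\<close>; evaluation at
  \<open>z\<close> gives the identity directly.\<close>

lemma unitary_kernel_eq:
  assumes phi: "\<phi> \<in> X \<rightarrow> X" and co: "unitary_operator H ip (weighted_comp X \<delta> \<phi>)"
    and z: "z \<in> X" and w: "w \<in> X"
  shows "K z w = \<delta> z * cnj (\<delta> w) * K (\<phi> z) (\<phi> w)"
proof -
  let ?W = "weighted_comp X \<delta> \<phi>"
  have W: "\<And>f. f \<in> H \<Longrightarrow> ?W f \<in> H"
    and inv: "?W (hilbert_adjoint H ip ?W (ker w)) = ker w"
    using co kernel_mem[OF w] by (auto simp: unitary_operator_def bounded_operator_def)
  have adj: "hilbert_adjoint H ip ?W (ker w) = (\<lambda>x. cnj (\<delta> w) * ker (\<phi> w) x)"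
    by (rule adjoint_weighted_comp_ker[OF phi W w])
  have "\<phi> z \<in> X" using phi z by auto
  then show ?thesis
    using fun_cong[OF inv[unfolded adj], of z] z by (simp add: weighted_comp_def kernel_fun_def mult.assoc)
qed

text \<open>The operator sends \<open>ker w\<close> to \<open>c\<close> times
  \<open>ker (\<psi> w)\<close>, because \<open>w = \<phi> (\<psi> w)\<close> and \<open>K\<close>
  is invariant. The general case follows by \<open>closed_subspace_eq\<close>. Membership of the
  image in \<open>H\<close> has to be proved along with the isometry, since it is what passing to
  limits requires.\<close>

lemma weighted_comp_isometric:
  assumes phi: "\<phi> \<in> X \<rightarrow> X" and psi: "\<psi> \<in> X \<rightarrow> X"
    and inv: "\<And>w. w \<in> X \<Longrightarrow> \<phi> (\<psi> w) = w"
    and K: "\<And>z w. z \<in> X \<Longrightarrow> w \<in> X \<Longrightarrow> K (\<phi> z) (\<phi> w) = K z w"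
    and c: "cmod c = 1" and delta: "\<And>z. z \<in> X \<Longrightarrow> \<delta> z = c"
    and g: "g \<in> H"
  shows "weighted_comp X \<delta> \<phi> g \<in> H"
    and "h \<in> H \<Longrightarrow> ip (weighted_comp X \<delta> \<phi> g) (weighted_comp X \<delta> \<phi> h) = ip g h"
proof -
  let ?W = "weighted_comp X \<delta> \<phi>"
  \<comment> \<open>Unlike preservation of norms, this condition is linear in \<open>g\<close>.\<close>
  define S where "S = {g \<in> H. ?W g \<in> H \<and> (\<forall>h\<in>H. ?W h \<in> H \<longrightarrow> ip (?W g) (?W h) = ip g h)}"
  have Wadd: "?W (\<lambda>x. f x + g x) = (\<lambda>x. ?W f x + ?W g x)" for f g
    by (auto simp: weighted_comp_def algebra_simps)
  have Wdiff: "?W (\<lambda>x. f x - g x) = (\<lambda>x. ?W f x - ?W g x)" for f g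
    by (auto simp: weighted_comp_def algebra_simps)
  have Wscale: "?W (\<lambda>x. c * g x) = (\<lambda>x. c * ?W g x)" for c g
    by (auto simp: weighted_comp_def algebra_simps)
  have W0: "?W (\<lambda>x. 0) = (\<lambda>x. 0)" by (auto simp: weighted_comp_def)
  have c1: "c * cnj c = 1" using complex_norm_square[of c] c by simp
  have "S = H"
  proof (rule closed_subspace_eq)
    show "S \<subseteq> H" by (auto simp: S_def)
    show "(\<lambda>x. 0) \<in> S"
      using zero_mem ip_scale_left[OF zero_mem, of _ 0] by (auto simp: S_def W0)
    show "(\<lambda>x. f x + g x) \<in> S" if "f \<in> S" "g \<in> S" for f g
      using that by (auto simp: S_def Wadd add_mem ip_add_left)
    show "(\<lambda>x. c * g x) \<in> S" if "g \<in> S" for c g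
      using that by (auto simp: S_def Wscale scale_mem ip_scale_left)
    show "ker w \<in> S" if w: "w \<in> X" for w
    proof -
      have pw: "\<psi> w \<in> X" using psi w by blast
      have Wk: "?W (ker w) = (\<lambda>x. c * ker (\<psi> w) x)"
        using phi K[OF _ pw] inv[OF w] by (auto simp: weighted_comp_def kernel_fun_def delta fun_eq_iff)
      have "ip (?W (ker w)) (?W h) = ip (ker w) h" if h: "h \<in> H" "?W h \<in> H" for h
      proof -
        have "ip (?W h) (ker (\<psi> w)) = c * ip h (ker w)"
          using reproducing[OF h(2) pw] reproducing[OF h(1) w] pw inv[OF w]
          by (simp add: weighted_comp_def delta)
        then have "ip (ker (\<psi> w)) (?W h) = cnj c * ip (ker w) h"
          using ip_commute[OF h(2) kernel_mem[OF pw]] ip_commute[OF h(1) kernel_mem[OF w]] by simp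
        then show ?thesis using ip_scale_left[OF kernel_mem[OF pw] h(2), of c] c1
          by (simp add: Wk mult.assoc[symmetric])
      qed
      then show ?thesis using Wk kernel_mem w pw by (auto simp: S_def scale_mem)
    qed
    show "f \<in> S" if FS: "\<And>n. F n \<in> S" and f: "f \<in> H"
      and lim: "(\<lambda>n. nrm (\<lambda>x. F n x - f x)) \<longlonglongrightarrow> 0" for F f
    proof -
      have FH: "\<And>n. F n \<in> H" and WF: "\<And>n. ?W (F n) \<in> H" using FS by (auto simp: S_def)
      \<comment> \<open>Equal distances make the image sequence Cauchy, so completeness supplies a
        limit before the image of \<open>f\<close> is known to lie in \<open>H\<close>.\<close>
      have "nrm (\<lambda>x. ?W (F m) x - ?W (F n) x) = nrm (\<lambda>x. F m x - F n x)" for m n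
      proof -
        have d: "(\<lambda>x. F m x - F n x) \<in> H" and Wd: "?W (\<lambda>x. F m x - F n x) \<in> H"
          using FH WF by (auto simp: Wdiff diff_mem)
        have "ip (?W (\<lambda>x. F m x - F n x)) (?W (\<lambda>x. F m x - F n x)) =
            ip (\<lambda>x. F m x - F n x) (\<lambda>x. F m x - F n x)"
        proof -
          have "ip (?W (F k)) (?W (\<lambda>x. F m x - F n x)) = ip (F k) (\<lambda>x. F m x - F n x)" for k
            using FS[of k] d Wd unfolding S_def by blast
          then show ?thesis
            using ip_diff_left[OF FH FH d] ip_diff_left[OF WF WF Wd]
            by (simp add: Wdiff[of "F m" "F n"])
        qed
        then show ?thesis by (simp add: ip_norm_def Wdiff)
      qed
      then obtain h where h: "h \<in> H" and hl: "(\<lambda>n. nrm (\<lambda>x. ?W (F n) x - h x)) \<longlonglongrightarrow> 0"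
        using complete[of "\<lambda>n. ?W (F n)"] WF Cauchy_if_convergent[OF FH f lim] by auto
      \<comment> \<open>Norm limits are pointwise limits, and weighted composition commutes with
        pointwise limits.\<close>
      have "h x = ?W f x" for x
      proof (rule LIMSEQ_unique[OF pointwise_limit[OF WF h hl]])
        show "(\<lambda>n. ?W (F n) x) \<longlonglongrightarrow> ?W f x"
          using pointwise_limit[OF FH f lim] by (auto simp: weighted_comp_def intro!: tendsto_intros)
      qed
      then have hW: "h = ?W f" by auto
      have "ip (?W f) (?W k) = ip f k" if k: "k \<in> H" "?W k \<in> H" for k
        using ip_tendsto_left[OF WF h k(2) hl] ip_tendsto_left[OF FH f k(1) lim] FS k
        by (auto simp: S_def hW intro: LIMSEQ_unique)
      then show ?thesis using f h hW by (auto simp: S_def)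
    qed
  qed
  then show "?W g \<in> H" "h \<in> H \<Longrightarrow> ip (?W g) (?W h) = ip g h"
    using g by (auto simp: S_def)
qed

text \<open>The inverse \<open>?V\<close> is a weighted composition operator of the same kind and
  hence also isometric. Since \<open>ip (?W f) g = ip (?W f) (?W (?V g)) = ip f (?V g)\<close>, it
  is the adjoint.\<close>

lemma weighted_comp_unitary:
  assumes phi: "\<phi> \<in> X \<rightarrow> X" and psi: "\<psi> \<in> X \<rightarrow> X"
    and inv: "\<And>w. w \<in> X \<Longrightarrow> \<phi> (\<psi> w) = w"
    and inv': "\<And>w. w \<in> X \<Longrightarrow> \<psi> (\<phi> w) = w"
    and K: "\<And>z w. z \<in> X \<Longrightarrow> w \<in> X \<Longrightarrow> K (\<phi> z) (\<phi> w) = K z w"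
    and c: "cmod c = 1" and delta: "\<And>z. z \<in> X \<Longrightarrow> \<delta> z = c"
  shows "unitary_operator H ip (weighted_comp X \<delta> \<phi>)"
    and "coisometric_operator H ip (weighted_comp X \<delta> \<phi>)"
proof -
  let ?W = "weighted_comp X \<delta> \<phi>" and ?V = "weighted_comp X (\<lambda>_. cnj c) \<psi>"
  have K': "K (\<psi> z) (\<psi> w) = K z w" if "z \<in> X" "w \<in> X" for z w
    using K[of "\<psi> z" "\<psi> w"] psi that by (simp add: inv Pi_iff)
  have W: "?W f \<in> H" "h \<in> H \<Longrightarrow> ip (?W f) (?W h) = ip f h" if "f \<in> H" for f h
    by (rule weighted_comp_isometric[OF phi psi inv K c delta that]; assumption)+
  have c': "cmod (cnj c) = 1" using c by simp
  have V: "?V f \<in> H" "h \<in> H \<Longrightarrow> ip (?V f) (?V h) = ip f h" if "f \<in> H" for f h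
    by (rule weighted_comp_isometric[OF psi phi inv' K' c' refl that]; assumption)+
  have c1: "c * cnj c = 1" using complex_norm_square[of c] c by simp
  have WV: "?W (?V f) = f" if "f \<in> H" for f
    using phi supported[OF that] inv' c1
    by (auto simp: weighted_comp_def delta fun_eq_iff mult.assoc[symmetric])
  have VW: "?V (?W f) = f" if "f \<in> H" for f
    using psi supported[OF that] inv c1
    by (auto simp: weighted_comp_def delta fun_eq_iff mult.assoc[symmetric] mult.commute[of "cnj c"])
  have adj: "hilbert_adjoint H ip ?W g = ?V g" if g: "g \<in> H" for g
  proof (rule hilbert_adjoint_eqI)
    show "ip (?W f) g = ip f (?V g)" if f: "f \<in> H" for f
      using W(2)[OF f V(1)[OF g]] WV[OF g] by simp
  qed (use V W g in auto)
  have bdd: "bounded_operator H ip (weighted_comp X d p)"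
    if "\<And>f. f \<in> H \<Longrightarrow> weighted_comp X d p f \<in> H"
      "\<And>f h. f \<in> H \<Longrightarrow> h \<in> H \<Longrightarrow> ip (weighted_comp X d p f) (weighted_comp X d p h) = ip f h" for d p
    unfolding bounded_operator_def
    using that by (auto simp: ip_norm_def weighted_comp_def algebra_simps fun_eq_iff intro!: exI[of _ 1])
  have bW: "bounded_operator H ip ?W" and bV: "bounded_operator H ip ?V"
    using bdd W V by blast+
  then show "unitary_operator H ip ?W"
    by (auto simp: unitary_operator_def adj WV VW W(1))
  have "isometric_operator H ip (hilbert_adjoint H ip ?W)"
    using bV V(2)
    by (simp add: isometric_operator_def bounded_operator_def adj ip_norm_def add_mem scale_mem)
  then show "coisometric_operator H ip ?W"
    using bW by (simp add: coisometric_operator_def)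
qed

end

section \<open>Holomorphic functions on the unit disc\<close>

text \<open>Identity theorem on the punctured disc. It allows cancelling a factor \<open>z\<close>
  and disposing of a single exceptional parameter.\<close>

lemma holomorphic_zero_off_point:
  fixes g :: "complex \<Rightarrow> complex"
  assumes g: "g holomorphic_on ball 0 1" and p: "p \<in> ball 0 1"
    and zero: "\<And>z. z \<in> ball 0 1 \<Longrightarrow> z \<noteq> p \<Longrightarrow> g z = 0" and z: "z \<in> ball 0 1"
  shows "g z = 0"
proof (rule analytic_continuation[OF g _ _ _ p _ _ z, of "ball 0 1 - {p}"])
  show "p islimpt ball 0 1 - {p}"
    using p by (simp add: islimpt_punctured[symmetric] interior_limit_point)
qed (auto simp: zero)

text \<open>The first and second derivatives of \<open>eq\<close> in \<open>s\<close>, taken at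
  \<open>s = 0\<close> with \<open>t\<close> and \<open>Y\<close> held fixed. In the application
  \<open>Y\<close> is the value \<open>y t\<close> of a second function.\<close>

lemma product_identity_derivatives:
  fixes f x :: "complex \<Rightarrow> complex"
  assumes f: "f holomorphic_on ball 0 1" and x: "x holomorphic_on ball 0 1"
    and f0: "f 0 = 1" and R: "R \<in> ball 0 1" and R0: "R \<noteq> 0"
    and x0: "x 0 = R" and xD: "\<And>s. s \<in> ball 0 1 \<Longrightarrow> x s \<in> ball 0 1"
    and t: "t \<in> ball 0 1"
    and xY: "\<And>s. s \<in> ball 0 1 \<Longrightarrow> x s * Y / R \<in> ball 0 1"
    and eq: "\<And>s. s \<in> ball 0 1 \<Longrightarrow> f (s * t) * f Y * f (x s) = f R * f (x s * Y / R)"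
  shows "f Y * (deriv f 0 * t * f R + deriv f R * deriv x 0) = f R * deriv f Y * (deriv x 0 * Y / R)"
    and "f Y * (deriv (deriv f) 0 * t\<^sup>2 * f R + 2 * deriv f 0 * t * (deriv f R * deriv x 0)
            + deriv (deriv f) R * (deriv x 0)\<^sup>2 + deriv f R * deriv (deriv x) 0)
         = f R * (deriv (deriv f) Y * (deriv x 0 * Y / R)\<^sup>2 + deriv f Y * (deriv (deriv x) 0 * Y / R))"
proof -
  have df: "(f has_field_derivative deriv f z) (at z)"
    and ddf: "(deriv f has_field_derivative deriv (deriv f) z) (at z)" if "z \<in> ball 0 1" for z
    using that f holomorphic_deriv[OF f] by (auto intro!: holomorphic_derivI[of _ "ball 0 1"])
  have dx: "(x has_field_derivative deriv x s) (at s)"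
    and ddx: "(deriv x has_field_derivative deriv (deriv x) s) (at s)" if "s \<in> ball 0 1" for s
    using that x holomorphic_deriv[OF x] by (auto intro!: holomorphic_derivI[of _ "ball 0 1"])
  have st: "s * t \<in> ball 0 1" if "s \<in> ball 0 1" for s
    using that t mult_strict_mono'[of "cmod s" 1 "cmod t" 1] by (auto simp: norm_mult)
  \<comment> \<open>The outer functions are arbitrary, so that the same rules serve for
    \<open>f\<close> and for \<open>deriv f\<close>.\<close>
  have chain: "((\<lambda>s. g (s * t)) has_field_derivative g' * t) (at s)"
      "((\<lambda>s. h (x s)) has_field_derivative h' * deriv x s) (at s)"
      "((\<lambda>s. k (x s * Y / R)) has_field_derivative k' * (deriv x s * Y / R)) (at s)"
    if "s \<in> ball 0 1" "(g has_field_derivative g') (at (s * t))"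
      "(h has_field_derivative h') (at (x s))" "(k has_field_derivative k') (at (x s * Y / R))"
    for s g g' h h' k k'
  proof -
    show "((\<lambda>s. g (s * t)) has_field_derivative g' * t) (at s)"
      by (rule DERIV_chain2[of g]) (use that in \<open>auto intro!: derivative_eq_intros\<close>)
    show "((\<lambda>s. h (x s)) has_field_derivative h' * deriv x s) (at s)"
      by (rule DERIV_chain2[of h]) (use that dx in auto)
    show "((\<lambda>s. k (x s * Y / R)) has_field_derivative k' * (deriv x s * Y / R)) (at s)"
      by (rule DERIV_chain2[of k]) (use that dx in \<open>auto intro!: DERIV_cmult_right DERIV_cdivide\<close>)
  qed
  \<comment> \<open>Kept at every \<open>s\<close> of the disc, because it is differentiated once
    more at 0.\<close>
  have eq1: "t * deriv f (s * t) * f Y * f (x s) + f (s * t) * f Y * (deriv f (x s) * deriv x s)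
      = f R * (deriv f (x s * Y / R) * (deriv x s * Y / R))" (is "?l s = ?r s")
    if s: "s \<in> ball 0 1" for s
  proof -
    note c = chain[OF s df[OF st[OF s]] df[OF xD[OF s]] df[OF xY[OF s]]]
    have "((\<lambda>s. f (s * t) * f Y * f (x s)) has_field_derivative ?l s) (at s)"
      by (rule derivative_eq_intros c | simp add: algebra_simps)+
    moreover have "((\<lambda>s. f R * f (x s * Y / R)) has_field_derivative ?r s) (at s)"
      by (rule DERIV_cmult c)+
    then have "((\<lambda>s. f (s * t) * f Y * f (x s)) has_field_derivative ?r s) (at s)"
      by (rule has_field_derivative_transform_within_open[of _ _ _ "ball 0 1"]) (use s eq in auto)
    ultimately show ?thesis by (rule DERIV_unique)
  qed
  have z: "(0::complex) \<in> ball 0 1" by simp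
  show "f Y * (deriv f 0 * t * f R + deriv f R * deriv x 0) = f R * deriv f Y * (deriv x 0 * Y / R)"
    using eq1[OF z] R0 by (simp add: x0 f0 algebra_simps)
  note c = chain[OF z df[OF st[OF z]] df[OF xD[OF z]] ddf[OF xY[OF z]]]
  note c' = chain[OF z ddf[OF st[OF z]] ddf[OF xD[OF z]] ddf[OF xY[OF z]]]
  let ?L = "t * (deriv (deriv f) 0 * t) * f Y * f R + t * deriv f 0 * f Y * (deriv f R * deriv x 0)
      + (deriv f 0 * t * f Y * (deriv f R * deriv x 0)
      + f Y * (deriv (deriv f) R * deriv x 0 * deriv x 0 + deriv f R * deriv (deriv x) 0))"
  let ?R = "f R * (deriv (deriv f) Y * (deriv x 0 * Y / R) * (deriv x 0 * Y / R)
      + deriv f Y * (deriv (deriv x) 0 * Y / R))"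
  have "(?l has_field_derivative ?L) (at 0)"
    by (rule derivative_eq_intros c c' ddx[OF z] refl | simp add: x0 f0 algebra_simps)+
  moreover have "(?r has_field_derivative ?R) (at 0)"
    using R0 by - (rule derivative_eq_intros c c' ddx[OF z] refl | simp add: x0 f0 algebra_simps)+
  then have "(?l has_field_derivative ?R) (at 0)"
    by (rule has_field_derivative_transform_within_open[of _ _ _ "ball 0 1"]) (use eq1 in auto)
  ultimately have "?L = ?R" by (rule DERIV_unique)
  then show "f Y * (deriv (deriv f) 0 * t\<^sup>2 * f R + 2 * deriv f 0 * t * (deriv f R * deriv x 0)
            + deriv (deriv f) R * (deriv x 0)\<^sup>2 + deriv f R * deriv (deriv x) 0)
         = f R * (deriv (deriv f) Y * (deriv x 0 * Y / R)\<^sup>2 + deriv f Y * (deriv (deriv x) 0 * Y / R))"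
    by (simp add: algebra_simps power2_eq_square)
qed

text \<open>Dividing \<open>f'' f = C f'\<^sup>2\<close> by \<open>f'\<^sup>2\<close> shows that \<open>f / f'\<close> is affine near the origin.\<close>

lemma log_derivative_ode:
  fixes f :: "complex \<Rightarrow> complex"
  assumes f: "f holomorphic_on ball 0 1" and f0: "f 0 = 1" and a: "deriv f 0 \<noteq> 0"
    and ode: "\<And>z. z \<in> ball 0 1 \<Longrightarrow> deriv (deriv f) z * f z = C * (deriv f z)\<^sup>2"
    and z: "z \<in> ball 0 1"
  shows "deriv f z * (1 - (C - 1) * deriv f 0 * z) = deriv f 0 * f z"
proof -
  have hf': "deriv f holomorphic_on ball 0 1" using f by (rule holomorphic_deriv) simp
  have df: "(f has_field_derivative deriv f z) (at z)"
    and ddf: "(deriv f has_field_derivative deriv (deriv f) z) (at z)" if "z \<in> ball 0 1" for z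
    using that f hf' by (auto intro!: holomorphic_derivI[of _ "ball 0 1"])
  have "continuous_on (ball 0 1) (deriv f)" by (rule holomorphic_on_imp_continuous_on[OF hf'])
  then have "isCont (deriv f) 0" by (simp add: continuous_on_eq_continuous_at)
  then obtain e where e: "e > 0" and ne: "\<And>z. dist 0 z < e \<Longrightarrow> deriv f z \<noteq> 0"
    using continuous_at_avoid[of 0 "deriv f" 0] a by blast
  define U where "U = ball (0::complex) (min e 1)"
  have U: "U \<subseteq> ball 0 1" "0 \<in> U" "convex U" "open U" using e by (auto simp: U_def)
  define h where "h z = f z / deriv f z - (1 - C) * z" for z
  have "(h has_field_derivative 0) (at z within U)" if zU: "z \<in> U" for z
  proof -
    have n: "deriv f z \<noteq> 0" using zU ne by (simp add: U_def)
    have zb: "z \<in> ball 0 1" using zU U by blast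
    have "(h has_field_derivative
        (deriv f z * deriv f z - f z * deriv (deriv f) z) / (deriv f z * deriv f z) - (1 - C)) (at z)"
      unfolding h_def using df[OF zb] ddf[OF zb] n
      by (auto intro!: derivative_eq_intros)
    also have "(deriv f z * deriv f z - f z * deriv (deriv f) z) / (deriv f z * deriv f z) - (1 - C) = 0"
      using ode[OF zb] n by (simp add: field_simps power2_eq_square)
    finally show ?thesis by (rule has_field_derivative_at_within)
  qed
  then obtain k where k: "\<And>z. z \<in> U \<Longrightarrow> h z = k"
    using has_field_derivative_zero_constant[OF U(3)] by blast
  have "k = 1 / deriv f 0" using k[OF U(2)] f0 by (simp add: h_def)
  then have near: "deriv f z * (1 - (C - 1) * deriv f 0 * z) - deriv f 0 * f z = 0" if "z \<in> U" for z
  proof -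
    have "f z / deriv f z = 1 / deriv f 0 + (1 - C) * z"
      using k[OF that] \<open>k = 1 / deriv f 0\<close> by (simp add: h_def algebra_simps)
    moreover have "deriv f z \<noteq> 0" using that ne by (simp add: U_def)
    ultimately have "f z = deriv f z * (1 / deriv f 0 + (1 - C) * z)" by (simp add: field_simps)
    also have "deriv f 0 * \<dots> = deriv f z * (1 - (C - 1) * deriv f 0 * z)"
      using a by (simp add: algebra_simps)
    finally show ?thesis by simp
  qed
  \<comment> \<open>With the denominator cleared, the relation is holomorphic on the whole disc,
    including possible zeros of \<open>deriv f\<close>, and extends from \<open>U\<close> by the
    identity theorem.\<close>
  have "deriv f z * (1 - (C - 1) * deriv f 0 * z) - deriv f 0 * f z = 0"
  proof (rule analytic_continuation[of "\<lambda>z. deriv f z * (1 - (C - 1) * deriv f 0 * z) - deriv f 0 * f z"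
        "ball 0 1" U 0 z])
    show "0 islimpt U" using U by (simp add: interior_limit_point interior_open)
  qed (use U f hf' near z in \<open>auto intro!: holomorphic_intros\<close>)
  then show ?thesis by simp
qed

text \<open>At \<open>Y = y t\<close> put \<open>P = f Y\<close>, \<open>Q = Y f'(Y)\<close> and
  \<open>S = Y^2 f''(Y)\<close>. The first-order identity expresses \<open>t P\<close> linearly in
  \<open>P\<close> and \<open>Q\<close>; inserting this into the second-order identity times
  \<open>P\<close> eliminates \<open>t\<close> and makes \<open>S P\<close> a quadratic form in
  \<open>P\<close> and \<open>Q\<close> with constant coefficients. The values \<open>y t\<close>
  accumulate at \<open>R\<close>, so the relation holds on the whole disc. Comparison at 0 removes
  two of the three coefficients and leaves \<open>f'' f = C f'^2\<close>, which
  \<open>log_derivative_ode\<close> integrates.\<close>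

lemma product_identity_imp_ode:
  fixes f x y :: "complex \<Rightarrow> complex"
  assumes f: "f holomorphic_on ball 0 1" and x: "x holomorphic_on ball 0 1"
    and f0: "f 0 = 1" and a: "deriv f 0 \<noteq> 0"
    and R: "R \<in> ball 0 1" and R0: "R \<noteq> 0" and fR: "f R \<noteq> 0"
    and x0: "x 0 = R" and x1: "deriv x 0 \<noteq> 0" and xD: "\<And>s. s \<in> ball 0 1 \<Longrightarrow> x s \<in> ball 0 1"
    and y: "isCont y 0" and y0: "y 0 = R" and yD: "\<And>t. t \<in> ball 0 1 \<Longrightarrow> y t \<in> ball 0 1"
    and xy: "\<And>s t. s \<in> ball 0 1 \<Longrightarrow> t \<in> ball 0 1 \<Longrightarrow> x s * y t / R \<in> ball 0 1"
    and eq: "\<And>s t. s \<in> ball 0 1 \<Longrightarrow> t \<in> ball 0 1 \<Longrightarrow>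
        f (s * t) * f (y t) * f (x s) = f R * f (x s * y t / R)"
  shows "\<exists>c. \<forall>z\<in>ball 0 1. deriv f z * (1 - c * z) = deriv f 0 * f z"
proof -
  have hf': "deriv f holomorphic_on ball 0 1" using f by (rule holomorphic_deriv) simp
  have hf'': "deriv (deriv f) holomorphic_on ball 0 1" using hf' by (rule holomorphic_deriv) simp
  note first = product_identity_derivatives(1)[OF f x f0 R R0 x0 xD _ xy eq]
  note second = product_identity_derivatives(2)[OF f x f0 R R0 x0 xD _ xy eq]
  define a where "a = deriv f 0"
  define f1 where "f1 = deriv f R"
  define f2 where "f2 = deriv (deriv f) R"
  define f20 where "f20 = deriv (deriv f) 0"
  define x1 where "x1 = deriv x 0"
  define x2 where "x2 = deriv (deriv x) 0"
  \<comment> \<open>\<open>al\<close> and \<open>be\<close> are the coefficients in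
    \<open>t P = al Q + be P\<close>; \<open>k\<close> is the coefficient of \<open>S P\<close> in
    the second-order identity times \<open>P\<close>. \<open>A\<close>, \<open>B\<close>,
    \<open>C\<close> are what remains after substitution and division by \<open>k\<close>.\<close>
  define k where "k = f R * x1\<^sup>2 / R\<^sup>2"
  define al where "al = x1 / (R * a)"
  define be where "be = - (f1 * x1 / (a * f R))"
  define n2 where "n2 = f2 * x1\<^sup>2 + f1 * x2"
  define A where "A = (f20 * f R * be\<^sup>2 + 2 * a * f1 * x1 * be + n2) / k"
  define B where "B = (2 * f20 * f R * al * be + 2 * a * f1 * x1 * al - f R * x2 / R) / k"
  define C where "C = f20 * f R * al\<^sup>2 / k"
  have a0: "a \<noteq> 0" and x10: "x1 \<noteq> 0" using assms by (auto simp: a_def x1_def)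
  then have k0: "k \<noteq> 0" using fR R0 by (simp add: k_def)
  define g where "g z = z\<^sup>2 * deriv (deriv f) z * f z - A * (f z)\<^sup>2 - B * (z * deriv f z) * f z
      - C * (z * deriv f z)\<^sup>2" for z
  have hg: "g holomorphic_on ball 0 1"
    unfolding g_def by (intro holomorphic_intros f hf' hf'')
  have gy: "g (y t) = 0" if t: "t \<in> ball 0 1" for t
  proof -
    define P where "P = f (y t)"
    define Q where "Q = y t * deriv f (y t)"
    define S where "S = (y t)\<^sup>2 * deriv (deriv f) (y t)"
    have "P * (a * t * f R + f1 * x1) = f R * Q * x1 / R"
      using first[OF _ t _ t _ t] by (simp add: P_def Q_def a_def f1_def x1_def mult_ac)
    then have tP: "t * P = al * Q + be * P"
      unfolding al_def be_def using a0 fR R0 by (simp add: field_simps)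
    have "P * (f20 * t\<^sup>2 * f R + 2 * a * t * (f1 * x1) + n2) = f R * (S * (x1 / R)\<^sup>2 + Q * (x2 / R))"
      using second[OF _ t _ t _ t]
      by (simp add: P_def Q_def S_def a_def f1_def x1_def n2_def f20_def f2_def x2_def
          mult_ac power_divide power_mult_distrib add.assoc)
    moreover have "k * (S * P) + f R * x2 / R * (Q * P) = P * (f R * (S * (x1 / R)\<^sup>2 + Q * (x2 / R)))"
      by (simp add: k_def power_divide algebra_simps)
    ultimately have "k * (S * P) + f R * x2 / R * (Q * P)
        = P * (P * (f20 * t\<^sup>2 * f R + 2 * a * t * (f1 * x1) + n2))"
      by simp
    also have "\<dots> = f20 * f R * (t * P)\<^sup>2 + 2 * a * f1 * x1 * (t * P) * P + n2 * P\<^sup>2"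
      by (simp add: power2_eq_square algebra_simps)
    also have "\<dots> = f20 * f R * (al * Q + be * P)\<^sup>2 + 2 * a * f1 * x1 * (al * Q + be * P) * P + n2 * P\<^sup>2"
      by (simp only: tP)
    also have "\<dots> = (k * A) * P\<^sup>2 + (k * B + f R * x2 / R) * (Q * P) + (k * C) * Q\<^sup>2"
    proof -
      have kk: "k * A = f20 * f R * be\<^sup>2 + 2 * a * f1 * x1 * be + n2"
        "k * B + f R * x2 / R = 2 * f20 * f R * al * be + 2 * a * f1 * x1 * al"
        "k * C = f20 * f R * al\<^sup>2"
        using k0 by (simp_all add: A_def B_def C_def)
      show ?thesis unfolding kk by (simp add: power2_eq_square algebra_simps)
    qed
    finally have "k * (S * P) = k * (A * P\<^sup>2 + B * (Q * P) + C * Q\<^sup>2)"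
      by (simp add: algebra_simps)
    then have "S * P = A * P\<^sup>2 + B * (Q * P) + C * Q\<^sup>2" using k0 by simp
    then show ?thesis by (simp add: g_def P_def Q_def S_def algebra_simps)
  qed
  \<comment> \<open>If \<open>y t = R\<close>, the terms with \<open>deriv f R\<close> in the
    first-order identity cancel and leave \<open>a * t * (f R)^2 = 0\<close>. So \<open>y\<close>
    takes values near \<open>R\<close> but different from it.\<close>
  have yR: "y t \<noteq> R" if t: "t \<in> ball 0 1" "t \<noteq> 0" for t
  proof
    assume "y t = R"
    then have "f R * (a * t * f R + f1 * x1) = f R * f1 * x1"
      using first[OF _ t(1) _ t(1) _ t(1)] R0 by (simp add: a_def f1_def x1_def)
    then show False using fR a0 t(2) by (simp add: algebra_simps)
  qed
  have lim: "R islimpt y ` (ball 0 1)"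
    unfolding islimpt_approachable
  proof (intro allI impI)
    fix e :: real assume "e > 0"
    then obtain d where d: "d > 0" "\<And>t. dist t 0 < d \<Longrightarrow> dist (y t) R < e"
      using y y0 by (metis continuous_at_eps_delta)
    define t where "t = complex_of_real (min d 1 / 2)"
    have "cmod t = min d 1 / 2" using d(1) by (simp add: t_def)
    then have "t \<in> ball 0 1" "t \<noteq> 0" "dist t 0 < d" using d(1) by auto
    then show "\<exists>x'\<in>y ` ball 0 1. x' \<noteq> R \<and> dist x' R < e" using yR d(2) by blast
  qed
  have g0: "g z = 0" if "z \<in> ball 0 1" for z
    by (rule analytic_continuation[OF hg _ _ _ R lim]) (use gy yD that in auto)
  \<comment> \<open>At 0 only the term with \<open>A\<close> survives; after division by
    \<open>z\<close>, only the one with \<open>B\<close>.\<close>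
  have A0: "A = 0" using g0[of 0] f0 by (simp add: g_def)
  define g1 where "g1 z = z * deriv (deriv f) z * f z - B * deriv f z * f z - C * z * (deriv f z)\<^sup>2" for z
  have g1: "g1 z = 0" if z: "z \<in> ball 0 1" for z
  proof (rule holomorphic_zero_off_point[of g1 0])
    show "g1 holomorphic_on ball 0 1" unfolding g1_def by (intro holomorphic_intros f hf' hf'')
    fix z :: complex assume z: "z \<in> ball 0 1" "z \<noteq> 0"
    have "z * g1 z = g z" by (simp add: g1_def g_def A0 power2_eq_square algebra_simps)
    then show "g1 z = 0" using g0 z by simp
  qed (use z in auto)
  have B0: "B = 0" using g1[of 0] f0 a0 by (simp add: g1_def a_def)
  define g2 where "g2 z = deriv (deriv f) z * f z - C * (deriv f z)\<^sup>2" for z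
  have g2: "g2 z = 0" if z: "z \<in> ball 0 1" for z
  proof (rule holomorphic_zero_off_point[of g2 0])
    show "g2 holomorphic_on ball 0 1" unfolding g2_def by (intro holomorphic_intros f hf' hf'')
    fix z :: complex assume z: "z \<in> ball 0 1" "z \<noteq> 0"
    have "z * g2 z = g1 z" by (simp add: g1_def g2_def B0 algebra_simps)
    then show "g2 z = 0" using g1 z by simp
  qed (use z in auto)
  show ?thesis
  proof (intro exI ballI)
    fix z :: complex assume "z \<in> ball 0 1"
    then show "deriv f z * (1 - (C - 1) * deriv f 0 * z) = deriv f 0 * f z"
      by (rule log_derivative_ode[OF f f0 \<open>deriv f 0 \<noteq> 0\<close>, rotated]) (use g2 in \<open>simp add: g2_def\<close>)
  qed
qed

text \<open>The equation for \<open>y\<close> makes it a Moebius map, \<open>y t = r (r + t) / (1 + c r t)\<close>, and this exceeds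
  \<open>r\<close> in modulus for some \<open>t < 1\<close> unless \<open>c \<ge> 1\<close>; a zero of \<open>f\<close> at \<open>1 / c\<close> rules out \<open>c > 1\<close>.\<close>

lemma ode_parameter_eq_1:
  fixes f y :: "complex \<Rightarrow> complex" and r k :: real
  assumes a: "a \<noteq> 0"
    and ode: "\<And>z. z \<in> ball 0 1 \<Longrightarrow> deriv f z * (1 - c * z) = a * f z"
    and pos: "\<And>u::real. 0 \<le> u \<Longrightarrow> u < 1 \<Longrightarrow> f (of_real u) \<noteq> 0"
    and r: "0 < r" "r < 1" and k: "0 < k" and R: "R = complex_of_real (r\<^sup>2)"
    and y0: "y 0 = R" and dy: "(y has_field_derivative of_real k * R) (at 0)"
    and yr: "\<And>t. t \<in> ball 0 1 \<Longrightarrow> cmod (y t) < r"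
    and fy: "\<And>t. t \<in> ball 0 1 \<Longrightarrow> f (y t) \<noteq> 0"
    and eq: "\<And>t. t \<in> ball 0 1 \<Longrightarrow>
      f (y t) * (a * t * f R + deriv f R * (of_real k * R)) = f R * deriv f (y t) * (of_real k * y t)"
  shows "c = 1"
proof -
  have rr: "r\<^sup>2 < 1" using r by (simp add: power_less_one_iff)
  have Rb: "R \<in> ball 0 1" using rr by (simp add: R norm_power)
  have R0: "R \<noteq> 0" using r by (simp add: R)
  have fR: "f R \<noteq> 0" using pos[of "r\<^sup>2"] rr by (simp add: R)
  have cR: "1 - c * R \<noteq> 0" using ode[OF Rb] a fR by auto
  \<comment> \<open>The differential equation at \<open>R\<close> and at \<open>y t\<close> replaces
    both values of \<open>deriv f\<close> in \<open>eq\<close>; the common nonzero factor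
    \<open>a * f R * f (y t)\<close> then cancels.\<close>
  have mob: "(1 - c * y t) * (t * (1 - c * R) + of_real k * R) = (1 - c * R) * (of_real k * y t)"
    if t: "t \<in> ball 0 1" for t
  proof -
    have yb: "y t \<in> ball 0 1" using yr[OF t] r by simp
    have "(a * f R * f (y t)) * ((1 - c * y t) * (t * (1 - c * R) + of_real k * R))
      = (1 - c * y t) * (1 - c * R) * (f (y t) * (a * t * f R))
        + (1 - c * y t) * f (y t) * (a * f R) * (of_real k * R)"
      by (simp add: algebra_simps)
    also have "\<dots> = (1 - c * y t) * (1 - c * R) * (f (y t) * (a * t * f R + deriv f R * (of_real k * R)))"
      unfolding ode[OF Rb, symmetric] by (simp add: algebra_simps)
    also have "\<dots> = (1 - c * R) * f R * (deriv f (y t) * (1 - c * y t)) * (of_real k * y t)"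
      unfolding eq[OF t] by (simp add: algebra_simps)
    also have "\<dots> = (a * f R * f (y t)) * ((1 - c * R) * (of_real k * y t))"
      unfolding ode[OF yb] by (simp add: algebra_simps)
    finally show ?thesis using a fR fy[OF t] by simp
  qed
  \<comment> \<open>Differentiating \<open>mob\<close> at 0 gives
    \<open>(1 - c R)^2 = (k r)^2\<close>, so \<open>1 - c R\<close> is real, and therefore
    \<open>c\<close> is real.\<close>
  define L where "L = (\<lambda>t. (1 - c * y t) * (t * (1 - c * R) + of_real k * R))"
  have "(L has_field_derivative - (c * (of_real k * R)) * (of_real k * R) + (1 - c * R) * (1 - c * R)) (at 0)"
    unfolding L_def by (rule derivative_eq_intros dy refl | simp add: y0)+
  moreover have "((\<lambda>t. (1 - c * R) * (of_real k * y t)) has_field_derivative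
      (1 - c * R) * (of_real k * (of_real k * R))) (at 0)"
    by (intro DERIV_cmult dy)
  then have "(L has_field_derivative (1 - c * R) * (of_real k * (of_real k * R))) (at 0)"
    by (rule has_field_derivative_transform_within_open[of _ _ _ "ball 0 1"]) (auto simp: L_def mob)
  ultimately have "- (c * (of_real k * R)) * (of_real k * R) + (1 - c * R) * (1 - c * R)
      = (1 - c * R) * (of_real k * (of_real k * R))"
    by (rule DERIV_unique)
  then have "(1 - c * R)\<^sup>2 = (of_real (k * r))\<^sup>2"
    by (simp add: R power2_eq_square algebra_simps)
  then have "1 - c * R = of_real (k * r) \<or> 1 - c * R = of_real (- (k * r))"
    by (simp add: power2_eq_iff)
  then obtain q where q: "1 - c * R = complex_of_real q" "q = k * r \<or> q = - (k * r)" by blast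
  have "c = of_real ((1 - q) / r\<^sup>2)"
    using q(1) R R0 r by (simp add: field_simps)
  then obtain c' where c': "c = complex_of_real c'" by blast
  have q': "q = 1 - c' * r\<^sup>2"
    using arg_cong[OF q(1), of Re] by (simp add: R c' del: of_real_power)
  have c1: "c' \<le> 1"
  proof (rule ccontr)
    assume *: "\<not> c' \<le> 1"
    then have "complex_of_real (1 / c') \<in> ball 0 1" by (simp add: norm_divide)
    from ode[OF this] have "f (of_real (1 / c')) = 0" using a * c' by simp
    then show False using pos[of "1 / c'"] * by simp
  qed
  \<comment> \<open>Decides the sign of the square root: \<open>c' \<le> 1\<close> and
    \<open>r < 1\<close> make \<open>q\<close> positive, so \<open>q = k * r\<close>.\<close>
  have "c' * r\<^sup>2 \<le> 1 * r\<^sup>2" using c1 by (intro mult_right_mono) auto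
  then have "q > 0" using q' rr by simp
  then have qk: "q = k * r" using q(2) k r by (smt (verit) mult_pos_pos)
  have key: "r * (t + r) < r * \<bar>1 + c' * r * t\<bar>" if t: "0 < t" "t < 1" for t
  proof -
    have tb: "complex_of_real t \<in> ball 0 1" using t by simp
    have "(1 - c * y t) * (t * complex_of_real (k * r) + of_real k * R) = complex_of_real (k * r) * (of_real k * y t)"
      using mob[OF tb] q(1) qk by simp
    then have "(of_real k * complex_of_real r) * ((1 - c * y t) * (t + r)) = (of_real k * complex_of_real r) * (of_real k * y t)"
      by (simp add: R power2_eq_square algebra_simps)
    then have "(1 - c * y t) * (t + r) = of_real k * y t" using k r by simp
    then have "r * ((1 - c * y t) * (t + r)) = complex_of_real (k * r) * y t"
      by (simp add: mult_ac)
    also have "complex_of_real (k * r) = 1 - c * R" using q(1) qk by simp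
    finally have "y t * (1 + c * r * t) = r * (t + r)"
      by (simp add: R power2_eq_square algebra_simps)
    then have "y t * complex_of_real (1 + c' * r * t) = complex_of_real (r * (t + r))"
      by (simp add: c')
    from arg_cong[OF this, of cmod] have "cmod (y t) * \<bar>1 + c' * r * t\<bar> = r * (t + r)"
      using t r by (simp only: norm_mult norm_of_real) simp
    moreover have "r * (t + r) > 0" using r t by simp
    ultimately have "\<bar>1 + c' * r * t\<bar> > 0" by (metis abs_ge_zero less_irrefl mult_zero_right order_le_less)
    then have "cmod (y t) * \<bar>1 + c' * r * t\<bar> < r * \<bar>1 + c' * r * t\<bar>"
      using yr[OF tb] by simp
    then show ?thesis using \<open>cmod (y t) * \<bar>1 + c' * r * t\<bar> = r * (t + r)\<close> by simp
  qed
  have key: "t + r < \<bar>1 + c' * r * t\<bar>" if t: "0 < t" "t < 1" for t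
    using key[OF that] r by simp
  have "c' \<ge> 1"
  proof (rule ccontr)
    assume *: "\<not> c' \<ge> 1"
    then have "c' * r < r" using r by simp
    \<comment> \<open>The solution of \<open>t + r = 1 + c' r t\<close>, which lies between 0 and 1
      because \<open>c' r < r < 1\<close>. It contradicts \<open>key\<close> as long as
      \<open>1 + c' r t\<close> is nonnegative.\<close>
    define t where "t = (1 - r) / (1 - c' * r)"
    have t: "0 < t" "t < 1" "t * (1 - c' * r) = 1 - r"
    proof -
      have "0 < (1 - r) / (1 - m) \<and> (1 - r) / (1 - m) < 1 \<and> (1 - r) / (1 - m) * (1 - m) = 1 - r" if "m < r" for m
        using that r by (auto simp: field_simps)
      from this[OF \<open>c' * r < r\<close>] show "0 < t" "t < 1" "t * (1 - c' * r) = 1 - r"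
        by (auto simp: t_def)
    qed
    show False
    proof (cases "1 + c' * r * t \<ge> 0")
      case True
      then show False using key[OF t(1,2)] t(3) by (simp add: algebra_simps)
    next
      case False
      \<comment> \<open>Otherwise \<open>1 + c' r u\<close> has a zero \<open>u\<close> between 0
        and \<open>t\<close>, where \<open>key\<close> would give \<open>u + r < 0\<close>.\<close>
      then have neg: "c' * r * t < -1" by simp
      then have cr: "c' * r < 0" using t(1) by (smt (verit) mult_nonneg_nonneg)
      then have "0 < - 1 / (c' * r)" "- 1 / (c' * r) < t" using neg by (auto simp: field_simps)
      moreover have "c' * r * (- 1 / (c' * r)) = -1" using cr by auto
      ultimately obtain u where "0 < u" "u < t" "c' * r * u = -1" by blast
      then show False using key[of u] t(2) r by simp
    qed
  qed
  then show ?thesis using c1 c' by simp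
qed

text \<open>The product of \<open>f\<close> with \<open>(1 - z) powr a\<close> has derivative zero
  and value 1 at 0. The principal branch is holomorphic here because \<open>1 - z\<close> has
  positive real part.\<close>

lemma log_derivative_pole_powr:
  fixes f :: "complex \<Rightarrow> complex"
  assumes f: "f holomorphic_on ball 0 1" and f0: "f 0 = 1"
    and ode: "\<And>z. z \<in> ball 0 1 \<Longrightarrow> deriv f z * (1 - z) = a * f z" and z: "z \<in> ball 0 1"
  shows "f z = (1 - z) powr (- a)"
proof -
  define h where "h z = f z * (1 - z) powr a" for z
  have re: "1 - z \<notin> \<real>\<^sub>\<le>\<^sub>0" if "z \<in> ball 0 1" for z :: complex
  proof -
    have "Re z < 1" using that abs_Re_le_cmod[of z] by simp
    then show ?thesis by (auto simp: complex_nonpos_Reals_iff)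
  qed
  have "(h has_field_derivative 0) (at z within ball 0 1)" if zb: "z \<in> ball 0 1" for z
  proof -
    have n: "1 - z \<noteq> 0" using zb by auto
    have d: "(f has_field_derivative deriv f z) (at z)" using holomorphic_derivI[OF f _ zb] by simp
    have "((\<lambda>z. (1 - z) powr a) has_field_derivative a * (1 - z) powr (a - 1) * (- 1)) (at z)"
      by (rule DERIV_chain2[of "\<lambda>u. u powr a" _ "\<lambda>z. 1 - z"])
        (auto intro!: derivative_eq_intros has_field_derivative_powr re[OF zb])
    then have "(h has_field_derivative
        deriv f z * (1 - z) powr a + (a * (1 - z) powr (a - 1) * (- 1)) * f z) (at z)"
      unfolding h_def by (rule DERIV_mult'[OF d, THEN DERIV_cong]) (simp add: algebra_simps)
    also have "(1 - z) powr a = (1 - z) * (1 - z) powr (a - 1)"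
      using n by (simp add: powr_diff)
    also have "deriv f z * ((1 - z) * (1 - z) powr (a - 1)) + (a * (1 - z) powr (a - 1) * (- 1)) * f z
        = (deriv f z * (1 - z) - a * f z) * (1 - z) powr (a - 1)"
      by (simp add: algebra_simps)
    also have "\<dots> = 0" using ode[OF zb] by simp
    finally show ?thesis by (rule has_field_derivative_at_within)
  qed
  then obtain k where k: "\<And>z. z \<in> ball 0 1 \<Longrightarrow> h z = k"
    using has_field_derivative_zero_constant[of "ball 0 1" h] by auto
  have "k = 1" using k[of 0] f0 by (simp add: h_def)
  moreover have "(1 - z) powr a \<noteq> 0" using z by auto
  ultimately show ?thesis using k[OF z] by (simp add: h_def powr_minus field_simps)
qed

section \<open>The complex inner product\<close>

lemma cinner_add_left: "cinner (x + y) z = cinner x z + cinner y z"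
  by (simp add: cinner_def algebra_simps sum.distrib)

lemma cinner_diff_left: "cinner (x - y) z = cinner x z - cinner y z"
  by (simp add: cinner_def algebra_simps sum_subtractf)

lemma cinner_diff_right: "cinner z (x - y) = cinner z x - cinner z y"
  by (simp add: cinner_def algebra_simps sum_subtractf)

lemma cinner_scale_left: "cinner (c *s x) z = c * cinner x z"
  by (simp add: cinner_def sum_distrib_left mult_ac)

lemma cinner_scale_right: "cinner z (c *s x) = cnj c * cinner z x"
  by (simp add: cinner_def sum_distrib_left mult_ac)

lemma cinner_commute: "cinner w z = cnj (cinner z w)"
  by (simp add: cinner_def mult.commute)

lemma cinner_zero [simp]: "cinner 0 z = 0" "cinner z 0 = 0"
  by (simp_all add: cinner_def)

lemma cinner_axis_right: "cinner z (axis i c) = z $ i * cnj c"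
  unfolding cinner_def by (subst sum.remove[of _ i]) (auto simp: axis_def intro!: sum.neutral)

lemma cinner_axis_axis: "cinner (axis i c) (axis i d) = c * cnj d"
  unfolding cinner_axis_right by (simp add: axis_def)

lemma cinner_self: "cinner z z = of_real ((norm z)\<^sup>2)"
proof -
  have "(norm z)\<^sup>2 = (\<Sum>i\<in>UNIV. (cmod (z $ i))\<^sup>2)"
    by (simp add: norm_vec_def L2_set_def sum_nonneg)
  then show ?thesis
    by (simp only: cinner_def of_real_sum complex_norm_square)
qed

lemma cinner_self_eq_0: "cinner z z = 0 \<longleftrightarrow> z = 0"
  by (simp add: cinner_self)

lemma norm_scale_vec: "norm (c *s (z :: complex ^ 'd)) = cmod c * norm z"
proof -
  have "complex_of_real ((norm (c *s z))\<^sup>2) = (c * cnj c) * cinner z z"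
    by (simp only: cinner_self[symmetric] cinner_scale_left cinner_scale_right mult_ac)
  also have "\<dots> = of_real ((cmod c * norm z)\<^sup>2)"
    by (simp only: cinner_self complex_norm_square[symmetric] power_mult_distrib of_real_mult of_real_power)
  finally have "complex_of_real ((norm (c *s z))\<^sup>2) = of_real ((cmod c * norm z)\<^sup>2)" .
  then have "(norm (c *s z))\<^sup>2 = (cmod c * norm z)\<^sup>2" by (simp only: of_real_eq_iff)
  then show ?thesis by simp
qed

lemma norm_axis: "norm (axis i c :: complex ^ 'd) = cmod c"
proof -
  have "complex_of_real ((norm (axis i c :: complex ^ 'd))\<^sup>2) = c * cnj c"
    using cinner_self[of "axis i c :: complex ^ 'd"]
    by (simp add: cinner_axis_axis)
  then have "(norm (axis i c :: complex ^ 'd))\<^sup>2 = (cmod c)\<^sup>2"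
    using complex_norm_square[of c] by (metis of_real_eq_iff)
  then show ?thesis by simp
qed

lemma cinner_Cauchy_Schwarz: "cmod (cinner z w) \<le> norm z * norm w"
proof -
  have "cmod (cinner z w) \<le> (\<Sum>i\<in>UNIV. \<bar>cmod (z $ i)\<bar> * \<bar>cmod (w $ i)\<bar>)"
    unfolding cinner_def by (rule order_trans[OF norm_sum]) (simp add: norm_mult)
  also have "\<dots> \<le> norm z * norm w"
    unfolding norm_vec_def by (rule L2_set_mult_ineq)
  finally show ?thesis .
qed

lemma cinner_in_disc: "z \<in> unit_ball \<Longrightarrow> w \<in> unit_ball \<Longrightarrow> cinner z w \<in> ball 0 1"
  using cinner_Cauchy_Schwarz[of z w] mult_strict_mono'[of "norm z" 1 "norm w" 1] by auto

lemma scale_in_unit_ball: "t \<in> ball 0 1 \<Longrightarrow> norm e \<le> 1 \<Longrightarrow> t *s e \<in> unit_ball"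
  using mult_left_mono[of "norm e" 1 "cmod t"] by (auto simp: norm_scale_vec)

section \<open>Adjoint and unitary matrices\<close>

definition adj_matrix :: "complex ^ 'd ^ 'd \<Rightarrow> complex ^ 'd ^ 'd" where
  "adj_matrix U = (\<chi> i j. cnj (U $ j $ i))"

lemma cinner_matrix_left: "cinner (U *v z) w = cinner z (adj_matrix U *v w)"
proof -
  have "cinner (U *v z) w = (\<Sum>i\<in>UNIV. \<Sum>j\<in>UNIV. U $ i $ j * z $ j * cnj (w $ i))"
    by (simp add: cinner_def matrix_vector_mult_def sum_distrib_right)
  also have "\<dots> = (\<Sum>j\<in>UNIV. \<Sum>i\<in>UNIV. U $ i $ j * z $ j * cnj (w $ i))" by (rule sum.swap)
  also have "\<dots> = cinner z (adj_matrix U *v w)"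
    by (simp add: cinner_def matrix_vector_mult_def adj_matrix_def sum_distrib_left mult_ac)
  finally show ?thesis .
qed

lemma unitary_matrix_iff:
  "unitary_matrix U \<longleftrightarrow> adj_matrix U ** U = mat 1 \<and> U ** adj_matrix U = mat 1"
  by (simp add: unitary_matrix_def adj_matrix_def Let_def)

text \<open>Orthonormal columns say that the adjoint is a left inverse, and a left inverse of a
  square matrix is also a right inverse.\<close>

lemma unitary_matrixI:
  fixes U :: "complex ^ 'd ^ 'd"
  assumes "\<And>i j. cinner (U *v axis j 1) (U *v axis i 1) = (if i = j then 1 else 0)"
  shows "unitary_matrix U"
proof -
  have "(adj_matrix U ** U) $ i $ j = (mat 1 :: complex ^ 'd ^ 'd) $ i $ j" for i j
  proof -
    have "(U *v axis k 1) $ l = U $ l $ k" for k l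
      unfolding matrix_vector_mult_def by (simp add: axis_def if_distrib cong: if_cong)
    then show ?thesis
      using assms[of j i]
      by (simp add: cinner_def matrix_matrix_mult_def adj_matrix_def mat_def mult.commute eq_commute)
  qed
  then have "adj_matrix U ** U = mat 1" by (simp add: vec_eq_iff)
  then show ?thesis using matrix_left_right_inverse unitary_matrix_iff by blast
qed

lemma unitary_matrix_cinner:
  assumes "unitary_matrix U"
  shows "cinner (U *v z) (U *v w) = cinner z w"
    and "cinner (adj_matrix U *v z) (adj_matrix U *v w) = cinner z w"
proof -
  have a: "adj_matrix U *v (U *v v) = v" "U *v (adj_matrix U *v v) = v" for v
    using assms by (simp_all add: unitary_matrix_iff matrix_vector_mul_assoc)
  show "cinner (U *v z) (U *v w) = cinner z w" by (simp add: cinner_matrix_left a)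
  show "cinner (adj_matrix U *v z) (adj_matrix U *v w) = cinner z w"
    using cinner_matrix_left[of U "adj_matrix U *v z" w] by (simp add: a)
qed

lemma norm_eq_if_cinner: "cinner z z = cinner w w \<Longrightarrow> norm z = norm w"
  by (simp add: cinner_self flip: of_real_power)

section \<open>The kernel identity on the ball\<close>

text \<open>Collects what the geometric argument uses, apart from the Hilbert space.
  \<open>pos\<close> comes from nonnegative coefficients with constant term 1, and
  \<open>hol\<close> from holomorphy of the elements of \<open>H\<close> along complex
  lines.\<close>

locale kernel_identity =
  fixes f :: "complex \<Rightarrow> complex" and \<phi> :: "complex ^ 'd \<Rightarrow> complex ^ 'd" and \<delta> :: "complex ^ 'd \<Rightarrow> complex"
  assumes hf: "f holomorphic_on ball 0 1" and f0: "f 0 = 1" and a0: "deriv f 0 \<noteq> 0"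
    and pos: "\<And>u::real. 0 \<le> u \<Longrightarrow> u < 1 \<Longrightarrow> f (of_real u) \<noteq> 0"
    and phi: "\<And>z. z \<in> unit_ball \<Longrightarrow> \<phi> z \<in> unit_ball"
    and ker_eq: "\<And>z w. z \<in> unit_ball \<Longrightarrow> w \<in> unit_ball \<Longrightarrow>
          f (cinner z w) = \<delta> z * cnj (\<delta> w) * f (cinner (\<phi> z) (\<phi> w))"
    and hol: "\<And>e p. norm e \<le> 1 \<Longrightarrow> (\<lambda>t. cinner (\<phi> (t *s e)) p) holomorphic_on ball 0 1"
begin

text \<open>The complex directional derivative of \<open>\<phi>\<close> at the origin. Holomorphy is
  available only along each line separately, so additivity in \<open>e\<close> is not built
  in.\<close>

definition D :: "complex ^ 'd \<Rightarrow> complex ^ 'd" where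
  "D e = (\<chi> i. deriv (\<lambda>t. \<phi> (t *s e) $ i) 0)"

definition b :: "complex ^ 'd" where "b = \<phi> 0"

definition R :: complex where "R = cinner b b"

lemma b_ball: "b \<in> unit_ball"
  unfolding b_def by (rule phi) simp

lemma R_disc: "R \<in> ball 0 1"
  unfolding R_def by (rule cinner_in_disc[OF b_ball b_ball])

lemma df: "z \<in> ball 0 1 \<Longrightarrow> (f has_field_derivative deriv f z) (at z)"
  by (rule holomorphic_derivI[OF hf]) auto

lemma ddf: "z \<in> ball 0 1 \<Longrightarrow> (deriv f has_field_derivative deriv (deriv f) z) (at z)"
  by (rule holomorphic_derivI[OF holomorphic_deriv[OF hf]]) auto

lemma D_derivative:
  assumes e: "norm e \<le> 1"
  shows "((\<lambda>t. cinner (\<phi> (t *s e)) p) has_field_derivative cinner (D e) p) (at 0)"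
proof -
  have "((\<lambda>t. \<phi> (t *s e) $ i) has_field_derivative D e $ i) (at 0)" for i
    using holomorphic_derivI[OF hol[OF e, of "axis i 1"], of 0]
    by (simp add: cinner_axis_right D_def)
  then show ?thesis
    unfolding cinner_def by (intro DERIV_sum DERIV_cmult_right)
qed

text \<open>If one argument of \<open>ker_eq\<close> is 0, the left side is \<open>f 0 = 1\<close>,
  so no factor on the right vanishes.\<close>

lemma nonzero:
  assumes z: "z \<in> unit_ball"
  shows "f (cinner b (\<phi> z)) \<noteq> 0" "f (cinner (\<phi> z) b) \<noteq> 0" "\<delta> z \<noteq> 0"
  using ker_eq[of 0 z] ker_eq[of z 0] z f0 by (auto simp: b_def)

lemma fR: "f R \<noteq> 0"
  using nonzero(1)[of 0] by (simp add: R_def b_def)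

text \<open>The instances of \<open>ker_eq\<close> at \<open>(0, z)\<close>, \<open>(w, 0)\<close>
  and \<open>(0, 0)\<close> eliminate \<open>\<delta>\<close>.\<close>

lemma three_term:
  assumes z: "z \<in> unit_ball" and w: "w \<in> unit_ball"
  shows "f (cinner w z) * f (cinner b (\<phi> z)) * f (cinner (\<phi> w) b) = f R * f (cinner (\<phi> w) (\<phi> z))"
proof -
  have 1: "1 = \<delta> 0 * cnj (\<delta> z) * f (cinner b (\<phi> z))"
    "1 = \<delta> w * cnj (\<delta> 0) * f (cinner (\<phi> w) b)"
    "1 = \<delta> 0 * cnj (\<delta> 0) * f R"
    using ker_eq[of 0 z] ker_eq[of w 0] ker_eq[of 0 0] z w f0 by (auto simp: b_def R_def)
  have "\<delta> 0 * cnj (\<delta> 0) * (f (cinner w z) * f (cinner b (\<phi> z)) * f (cinner (\<phi> w) b))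
      = f (cinner (\<phi> w) (\<phi> z)) * (\<delta> 0 * cnj (\<delta> z) * f (cinner b (\<phi> z)))
        * (\<delta> w * cnj (\<delta> 0) * f (cinner (\<phi> w) b))"
    unfolding ker_eq[OF w z] by (simp add: mult_ac)
  also have "\<dots> = (\<delta> 0 * cnj (\<delta> 0) * f R) * f (cinner (\<phi> w) (\<phi> z))"
    unfolding 1[symmetric] by simp
  finally have "\<delta> 0 * cnj (\<delta> 0) * (f (cinner w z) * f (cinner b (\<phi> z)) * f (cinner (\<phi> w) b))
      = \<delta> 0 * cnj (\<delta> 0) * (f R * f (cinner (\<phi> w) (\<phi> z)))" by (simp only: mult.assoc)
  then show ?thesis using nonzero(3)[of 0] by simp
qed

text \<open>The derivative of \<open>three_term\<close> at \<open>s = 0\<close> along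
  \<open>w = s *s e\<close>, with \<open>z\<close> fixed.\<close>

lemma first_order:
  assumes e: "norm e \<le> 1" and z: "z \<in> unit_ball"
  shows "f (cinner b (\<phi> z)) * (deriv f 0 * cinner e z * f R + deriv f R * cinner (D e) b)
    = f R * (deriv f (cinner b (\<phi> z)) * cinner (D e) (\<phi> z))"
proof -
  let ?X = "cinner b (\<phi> z)"
  have X: "?X \<in> ball 0 1" using cinner_in_disc[OF b_ball phi[OF z]] .
  have at0: "cinner (\<phi> (0 *s e)) p = cinner b p" for p by (simp add: b_def)
  have d1: "((\<lambda>s. f (s * cinner e z)) has_field_derivative deriv f 0 * cinner e z) (at 0)"
    by (rule DERIV_chain2[of f]) (use df[of 0] in \<open>auto intro!: derivative_eq_intros\<close>)
  have d2: "((\<lambda>s. f (cinner (\<phi> (s *s e)) b)) has_field_derivative deriv f R * cinner (D e) b) (at 0)"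
    by (rule DERIV_chain2[of f, OF _ D_derivative[OF e]]) (use df[OF R_disc] in \<open>simp add: at0 R_def b_def\<close>)
  have d3: "((\<lambda>s. f (cinner (\<phi> (s *s e)) (\<phi> z))) has_field_derivative deriv f ?X * cinner (D e) (\<phi> z)) (at 0)"
    by (rule DERIV_chain2[of f, OF _ D_derivative[OF e]]) (use df[OF X] in \<open>simp add: b_def\<close>)
  have "((\<lambda>s. f (s * cinner e z) * f ?X * f (cinner (\<phi> (s *s e)) b)) has_field_derivative
      f ?X * (deriv f 0 * cinner e z * f R + deriv f R * cinner (D e) b)) (at 0)"
    by (rule derivative_eq_intros d1 d2 refl)+
      (simp add: f0 R_def b_def algebra_simps)
  moreover have "((\<lambda>s. f (s * cinner e z) * f ?X * f (cinner (\<phi> (s *s e)) b)) has_field_derivative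
      f R * (deriv f ?X * cinner (D e) (\<phi> z))) (at 0)"
  proof (rule has_field_derivative_transform_within_open[of _ _ _ "ball 0 1"])
    show "((\<lambda>s. f R * f (cinner (\<phi> (s *s e)) (\<phi> z))) has_field_derivative
        f R * (deriv f ?X * cinner (D e) (\<phi> z))) (at 0)"
      by (rule DERIV_cmult[OF d3])
    show "f R * f (cinner (\<phi> (s *s e)) (\<phi> z)) = f (s * cinner e z) * f ?X * f (cinner (\<phi> (s *s e)) b)"
      if "s \<in> ball 0 1" for s
      using three_term[OF z scale_in_unit_ball[OF that e]] by (simp add: cinner_scale_left)
  qed auto
  ultimately show ?thesis by (rule DERIV_unique)
qed

text \<open>The first-order relation says that \<open>cinner (D e) (Y z)\<close> is a multiple of \<open>cinner e z\<close> for
  a suitable \<open>Y\<close>, so \<open>D\<close> has a linear left inverse up to a factor.  That map is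
  surjective, hence injective by equality of dimensions, so \<open>D\<close> inverts it.\<close>

lemma D_surj:
  assumes p: "p \<noteq> 0"
  obtains e k where "norm e = 1" "0 < k" "D e = complex_of_real k *s p"
proof -
  define z :: "'d \<Rightarrow> complex ^ 'd" where "z i = axis i (1/2)" for i
  have z: "z i \<in> unit_ball" for i by (simp add: z_def norm_axis)
  \<comment> \<open>Chosen so that \<open>first_order\<close>, divided by \<open>f R\<close> and
    \<open>f (cinner b (\<phi> (z i)))\<close>, reads
    \<open>cinner (D e) (Y i) = deriv f 0 * cinner e (z i)\<close>. The conjugates compensate for
    conjugate linearity in the second slot.\<close>
  define Y where "Y i = cnj (deriv f (cinner b (\<phi> (z i))) / f (cinner b (\<phi> (z i)))) *s \<phi> (z i)
      - cnj (deriv f R / f R) *s b" for i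
  define M where "M v = (\<chi> i. cinner v (Y i))" for v
  have Mscale: "M (c *s v) = c *s M v" for c v
    by (simp add: M_def vec_eq_iff cinner_scale_left)
  have Madd: "M (u + v) = M u + M v" for u v
    by (simp add: M_def vec_eq_iff cinner_add_left)
  have scaleR: "r *\<^sub>R v = complex_of_real r *s v" for r and v :: "complex ^ 'd"
    by (simp add: vec_eq_iff scaleR_conv_of_real[symmetric])
  have Mlin: "linear M"
    by (rule linearI) (simp_all add: Madd Mscale scaleR)
  have MD: "M (D e) = (deriv f 0 / 2) *s e" if e: "norm e \<le> 1" for e
  proof -
    have "cinner (D e) (Y i) = deriv f 0 / 2 * e $ i" for i
    proof -
      have "cinner (D e) (Y i) * f R * f (cinner b (\<phi> (z i)))
          = f R * (deriv f (cinner b (\<phi> (z i))) * cinner (D e) (\<phi> (z i)))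
            - f (cinner b (\<phi> (z i))) * (deriv f R * cinner (D e) b)"
        unfolding Y_def cinner_diff_right cinner_scale_right
        using fR nonzero(1)[OF z[of i]] by (simp add: field_simps)
      also have "\<dots> = f (cinner b (\<phi> (z i))) * (deriv f 0 * cinner e (z i) * f R)"
        unfolding first_order[OF e z, symmetric] by (simp add: algebra_simps)
      finally have "cinner (D e) (Y i) = deriv f 0 * cinner e (z i)"
        using fR nonzero(1)[OF z[of i]] by simp
      then show ?thesis by (simp add: z_def cinner_axis_right)
    qed
    then show ?thesis by (simp add: M_def vec_eq_iff)
  qed
  have "\<forall>v. \<exists>u. M u = v"
  proof
    fix v :: "complex ^ 'd"
    define N where "N = norm v + 1"
    have N: "N > 0" "norm v \<le> N" by (simp_all add: N_def add_nonneg_pos)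
    define e where "e = complex_of_real (1 / N) *s v"
    have "norm e \<le> 1"
      unfolding e_def norm_scale_vec norm_of_real using N by simp
    then have "M ((2 / deriv f 0 * of_real N) *s D e) = of_real N *s e"
      using a0 by (simp add: Mscale MD mult_ac)
    also have "\<dots> = v"
      using N by (simp add: e_def)
    finally show "\<exists>u. M u = v" by blast
  qed
  then have "surj M" by (metis surjI)
  then have inj: "inj M" using linear_surjective_imp_injective[OF Mlin] by blast
  have "M p \<noteq> 0" using p inj Mlin linear_injective_0 by blast
  \<comment> \<open>\<open>M\<close> sends \<open>D e\<close> to \<open>deriv f 0 / 2\<close> times
    \<open>e\<close>, so a direction with \<open>D e\<close> parallel to \<open>p\<close> has to be
    parallel to \<open>M p\<close>. Normalizing it gives \<open>k = 1 / norm e0\<close>.\<close>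
  define e0 where "e0 = (2 / deriv f 0) *s M p"
  have e0: "norm e0 > 0" using \<open>M p \<noteq> 0\<close> a0 by (simp add: e0_def norm_scale_vec)
  define e where "e = complex_of_real (1 / norm e0) *s e0"
  have e1: "norm e = 1" using e0 by (simp add: e_def norm_scale_vec norm_divide)
  have "M (D e) = M (complex_of_real (1 / norm e0) *s p)"
  proof -
    have "M (D e) = (deriv f 0 / 2) *s (complex_of_real (1 / norm e0) *s e0)"
      using MD[of e] e1 by (simp only: e_def)
    also have "\<dots> = complex_of_real (1 / norm e0) *s M p"
      using a0 by (subst (2) e0_def) simp
    finally show ?thesis by (simp only: Mscale)
  qed
  then have "D e = complex_of_real (1 / norm e0) *s p" using inj by (simp add: inj_eq)
  then show ?thesis using that[of e "1 / norm e0"] e1 e0 by simp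
qed

text \<open>For \<open>b = 0\<close>, \<open>first_order\<close> reads
  \<open>cinner (D e) (\<phi> z) = cinner e z\<close>. A matrix \<open>U\<close> built from values
  of \<open>\<phi>\<close> satisfies the same relation, and by \<open>D_surj\<close> the vectors
  \<open>D e\<close> separate points, so \<open>\<phi> = U\<close>. Then
  \<open>D e = U *v e\<close>, and the relation says that \<open>U\<close> preserves inner
  products.\<close>

lemma unitary_if_fixes_0:
  assumes b: "b = 0"
  obtains U c where "unitary_matrix U" "cmod c = 1"
    "\<And>z. z \<in> unit_ball \<Longrightarrow> \<phi> z = U *v z" "\<And>z. z \<in> unit_ball \<Longrightarrow> \<delta> z = c"
proof -
  have R0: "R = 0" by (simp add: R_def b)
  have De: "cinner (D e) (\<phi> z) = cinner e z" if "norm e \<le> 1" "z \<in> unit_ball" for e z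
    using first_order[OF that] a0 by (simp add: b R0 f0)
  define z0 :: "'d \<Rightarrow> complex ^ 'd" where "z0 i = axis i (1/2)" for i
  have z0: "z0 i \<in> unit_ball" for i by (simp add: z0_def norm_axis)
  \<comment> \<open>The columns are the values at half the basis vectors, rescaled, because the
    basis vectors lie outside the open ball.\<close>
  define U :: "complex ^ 'd ^ 'd" where "U = (\<chi> i j. 2 * \<phi> (z0 j) $ i)"
  have DU: "cinner (D e) (U *v z) = cinner e z" if e: "norm e \<le> 1" for e z
  proof -
    have "cinner (D e) (U *v z) = (\<Sum>i\<in>UNIV. \<Sum>j\<in>UNIV. D e $ i * cnj (2 * \<phi> (z0 j) $ i * z $ j))"
      by (simp add: cinner_def matrix_vector_mult_def U_def sum_distrib_left)
    also have "\<dots> = (\<Sum>j\<in>UNIV. \<Sum>i\<in>UNIV. D e $ i * cnj (2 * \<phi> (z0 j) $ i * z $ j))" by (rule sum.swap)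
    also have "\<dots> = (\<Sum>j\<in>UNIV. 2 * cinner (D e) (\<phi> (z0 j)) * cnj (z $ j))"
      by (simp add: cinner_def sum_distrib_left sum_distrib_right mult_ac)
    also have "\<dots> = cinner e z"
      unfolding De[OF e z0] unfolding z0_def cinner_axis_right by (simp add: cinner_def)
    finally show ?thesis .
  qed
  have phiU: "\<phi> z = U *v z" if z: "z \<in> unit_ball" for z
  proof (rule ccontr)
    assume "\<phi> z \<noteq> U *v z"
    then obtain e k where e: "norm e = 1" "0 < k" "D e = complex_of_real k *s (\<phi> z - U *v z)"
      using D_surj[of "\<phi> z - U *v z"] by auto
    have "cinner (D e) (\<phi> z - U *v z) = 0"
      using De[OF _ z, of e] DU[of e z] e(1) by (simp add: cinner_diff_right)
    then have "complex_of_real k * cinner (\<phi> z - U *v z) (\<phi> z - U *v z) = 0"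
      unfolding e(3) cinner_scale_left .
    then show False using e(2) \<open>\<phi> z \<noteq> U *v z\<close> by (simp add: cinner_self_eq_0)
  qed
  have Ue: "cinner (U *v e) p = cinner (D e) p" if e: "norm e \<le> 1" for e p
  proof -
    have "((\<lambda>t. t * cinner (U *v e) p) has_field_derivative cinner (D e) p) (at 0)"
    proof (rule has_field_derivative_transform_within_open[OF D_derivative[OF e], where S = "ball 0 1"])
      show "cinner (\<phi> (t *s e)) p = t * cinner (U *v e) p" if "t \<in> ball 0 1" for t
        by (simp add: phiU[OF scale_in_unit_ball[OF that e]] cinner_matrix_left cinner_scale_left)
    qed auto
    moreover have "((\<lambda>t. t * cinner (U *v e) p) has_field_derivative cinner (U *v e) p) (at 0)"
      by (auto intro!: derivative_eq_intros)
    ultimately show ?thesis using DERIV_unique by blast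
  qed
  have "unitary_matrix U"
  proof (rule unitary_matrixI)
    fix i j
    show "cinner (U *v axis j 1) (U *v axis i 1) = (if i = j then 1 else 0)"
      using Ue[of "axis j 1" "U *v axis i 1"] DU[of "axis j 1" "axis i 1"]
      by (simp add: norm_axis cinner_axis_right) (simp add: axis_def)
  qed
  \<comment> \<open>The kernel identity at \<open>w = 0\<close>, where both values of
    \<open>f\<close> are 1. It gives \<open>\<delta>\<close> modulus one at 0 and then the same
    value everywhere.\<close>
  moreover have d: "\<delta> z * cnj (\<delta> 0) = 1" if "z \<in> unit_ball" for z
    using ker_eq[OF that, of 0] f0 b by (simp add: b_def)
  then have "cmod (\<delta> 0) = 1"
  proof -
    have "(cmod (\<delta> 0))\<^sup>2 = 1"
      using arg_cong[OF d, of 0 cmod] by (simp add: norm_mult power2_eq_square)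
    then show ?thesis using norm_ge_zero[of "\<delta> 0"] by (simp add: power2_eq_1_iff)
  qed
  moreover have "\<delta> z = \<delta> 0" if "z \<in> unit_ball" for z
    using d[OF that] d[of 0] nonzero(3)[of 0]
    by (metis complex_cnj_zero_iff centre_in_ball mult_right_cancel zero_less_one)
  ultimately show ?thesis using that[of U "\<delta> 0"] phiU by blast
qed

text \<open>A direction \<open>e\<close> with \<open>D e\<close> a positive multiple of
  \<open>b\<close> spans a disc that \<open>\<phi>\<close> maps into the line through
  \<open>b\<close>. On this disc the kernel identity becomes the one-variable functional equation,
  which fixes \<open>f\<close> up to \<open>c\<close>, and boundedness of \<open>\<phi>\<close>
  forces \<open>c = 1\<close>.\<close>

lemma ode_if_not_fixes_0:
  assumes b0: "b \<noteq> 0" and z: "z \<in> ball 0 1"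
  shows "deriv f z * (1 - z) = deriv f 0 * f z"
proof -
  obtain e k where e: "norm e = 1" and k: "0 < k" and De: "D e = complex_of_real k *s b"
    using D_surj[OF b0] by blast
  have e1: "norm e \<le> 1" using e by simp
  define r where "r = norm b"
  have r: "0 < r" "r < 1" using b0 b_ball by (auto simp: r_def)
  have Rr: "R = complex_of_real (r\<^sup>2)" by (simp add: R_def r_def cinner_self)
  have R0: "R \<noteq> 0" using r by (simp add: Rr)
  have ball: "t *s e \<in> unit_ball" if "t \<in> ball 0 1" for t
    using scale_in_unit_ball[OF that e1] .
  have cnj_ball: "cnj t \<in> ball 0 1" if "t \<in> ball 0 1" for t using that by simp
  define x where "x s = cinner (\<phi> (s *s e)) b" for s
  \<comment> \<open>Conjugating \<open>t\<close> offsets the conjugate linear second slot: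
    \<open>y\<close> is differentiable at 0, and
    \<open>cinner (s *s e) (cnj t *s e) = s * t\<close>.\<close>
  define y where "y t = cinner b (\<phi> (cnj t *s e))" for t
  have hx: "x holomorphic_on ball 0 1" unfolding x_def by (rule hol[OF e1])
  have x0: "x 0 = R" and y0: "y 0 = R" by (simp_all add: x_def y_def R_def b_def)
  have dx: "(x has_field_derivative of_real k * R) (at 0)"
    using D_derivative[OF e1, of b] unfolding x_def De by (simp add: cinner_scale_left R_def)
  have conj_deriv: "((\<lambda>t. cinner p (\<phi> (cnj t *s e))) has_field_derivative cinner p (D e)) (at 0)" for p
    using has_field_derivative_cnj_cnj[of "\<lambda>t. cinner (\<phi> (t *s e)) p" "cinner (D e) p" 0]
      D_derivative[OF e1, of p]
    by (simp add: o_def cinner_commute[of p])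
  have dy: "(y has_field_derivative of_real k * R) (at 0)"
    using conj_deriv[of b] unfolding y_def De by (simp add: cinner_scale_right R_def)
  have yr: "cmod (y t) < r" if "t \<in> ball 0 1" for t
  proof -
    have "cmod (y t) \<le> r * norm (\<phi> (cnj t *s e))"
      unfolding y_def r_def by (rule cinner_Cauchy_Schwarz)
    also have "\<dots> < r * 1"
      using phi[OF ball[OF cnj_ball[OF that]]] r by (intro mult_strict_left_mono) auto
    finally show ?thesis by simp
  qed
  have yD: "y t \<in> ball 0 1" if "t \<in> ball 0 1" for t using yr[OF that] r by simp
  have fy: "f (y t) \<noteq> 0" if "t \<in> ball 0 1" for t
    unfolding y_def by (rule nonzero(1)[OF ball[OF cnj_ball[OF that]]])
  have first: "f (y t) * (deriv f 0 * (t * cinner e' e) * f R + deriv f R * cinner (D e') b)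
      = f R * (deriv f (y t) * cinner (D e') (\<phi> (cnj t *s e)))"
    if "t \<in> ball 0 1" "norm e' \<le> 1" for t e'
    using first_order[OF that(2) ball[OF cnj_ball[OF that(1)]]]
    by (simp add: y_def cinner_scale_right)
  have ee: "cinner e e = 1" by (simp add: cinner_self e)
  have line: "f (y t) * (deriv f 0 * t * f R + deriv f R * (of_real k * R))
      = f R * deriv f (y t) * (of_real k * y t)" if "t \<in> ball 0 1" for t
    using first[OF that e1] by (simp add: ee De cinner_scale_left R_def y_def[symmetric] mult_ac)

  \<comment> \<open>Take \<open>e'\<close> with \<open>D e'\<close> parallel to \<open>p\<close>.
    The function \<open>q\<close> vanishes at 0 together with its derivative, so comparing
    derivatives in \<open>eq\<close> gives \<open>cinner e' e = 0\<close>. What remains is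
    \<open>deriv f (y t) * q t = 0\<close>.\<close>
  have orth: "cinner p (\<phi> (cnj t *s e)) = 0" if p: "cinner p b = 0" and t: "t \<in> ball 0 1" for p t
  proof (cases "p = 0")
    case False
    then obtain e' k' where e': "norm e' = 1" "0 < k'" "D e' = complex_of_real k' *s p"
      using D_surj by blast
    define q where "q t = cinner p (\<phi> (cnj t *s e))" for t
    have hq: "q holomorphic_on ball 0 1"
    proof -
      have "cnj \<circ> (\<lambda>t. cinner (\<phi> (t *s e)) p) \<circ> cnj holomorphic_on ball 0 1"
        by (rule holomorphic_on_compose_cnj_cnj) (auto intro!: hol[OF e1, THEN holomorphic_on_subset])
      moreover have "cnj \<circ> (\<lambda>t. cinner (\<phi> (t *s e)) p) \<circ> cnj = q"
        by (simp add: fun_eq_iff q_def cinner_commute[of p])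
      ultimately show ?thesis by simp
    qed
    have q0: "q 0 = 0" using p by (simp add: q_def b_def)
    have dq: "(q has_field_derivative 0) (at 0)"
      using conj_deriv[of p] unfolding q_def De by (simp add: cinner_scale_right p)
    have eq: "f (y t) * (deriv f 0 * (t * cinner e' e) * f R) = f R * (deriv f (y t) * (of_real k' * q t))"
      if "t \<in> ball 0 1" for t
      using first[OF that, of e'] e' p by (simp add: cinner_scale_left q_def)
    have dfy: "((\<lambda>t. f (y t)) has_field_derivative deriv f R * (of_real k * R)) (at 0)"
      by (rule DERIV_chain2[OF _ dy]) (use df[OF R_disc] in \<open>simp add: y0\<close>)
    have ddfy: "((\<lambda>t. deriv f (y t)) has_field_derivative deriv (deriv f) R * (of_real k * R)) (at 0)"
      by (rule DERIV_chain2[OF _ dy]) (use ddf[OF R_disc] in \<open>simp add: y0\<close>)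
    have "((\<lambda>t. f (y t) * (deriv f 0 * (t * cinner e' e) * f R)) has_field_derivative
        f R * (deriv f 0 * cinner e' e * f R)) (at 0)"
      by (rule derivative_eq_intros dfy refl)+ (simp add: y0)
    moreover have "((\<lambda>t. f R * (deriv f (y t) * (of_real k' * q t))) has_field_derivative 0) (at 0)"
      by (rule derivative_eq_intros ddfy dq refl)+ (simp add: q0)
    then have "((\<lambda>t. f (y t) * (deriv f 0 * (t * cinner e' e) * f R)) has_field_derivative 0) (at 0)"
      by (rule has_field_derivative_transform_within_open[of _ _ _ "ball 0 1"]) (auto simp: eq)
    ultimately have "f R * (deriv f 0 * cinner e' e * f R) = 0" by (rule DERIV_unique)
    then have "cinner e' e = 0" using fR a0 by simp
    then have prod: "deriv f (y t) * q t = 0" if "t \<in> ball 0 1" for t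
      using eq[OF that] fR e'(2) by simp
    \<comment> \<open>By \<open>line\<close>, \<open>deriv f (y t) = 0\<close> imposes an equation
      affine in \<open>t\<close> whose only root is \<open>t0\<close>; elsewhere \<open>q\<close>
      must vanish.\<close>
    define t0 where "t0 = - (deriv f R * (of_real k * R)) / (deriv f 0 * f R)"
    have q: "q t = 0" if t: "t \<in> ball 0 1" "t \<noteq> t0" for t
    proof (rule ccontr)
      assume "q t \<noteq> 0"
      then have "deriv f (y t) = 0" using prod[OF t(1)] by simp
      then have "deriv f 0 * t * f R + deriv f R * (of_real k * R) = 0"
        using line[OF t(1)] fy[OF t(1)] by simp
      then show False using t(2) a0 fR by (simp add: t0_def field_simps add_eq_0_iff)
    qed
    have "q t = 0"
    proof (cases "t0 \<in> ball 0 1")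
      case True
      then show ?thesis using holomorphic_zero_off_point[OF hq True _ t] q by blast
    next
      case False
      then show ?thesis using q[OF t] t by blast
    qed
    then show ?thesis by (simp add: q_def)
  qed simp

  have on_line: "\<phi> (s *s e) = (x s / R) *s b" if s: "s \<in> ball 0 1" for s
  proof -
    \<comment> \<open>The component of \<open>\<phi> (s *s e)\<close> orthogonal to
      \<open>b\<close>. By \<open>orth\<close> it is orthogonal to \<open>\<phi> (s *s e)\<close> as
      well, hence to itself.\<close>
    define v where "v = \<phi> (s *s e) - (x s / R) *s b"
    have vb: "cinner v b = 0"
      using R0 by (simp add: v_def cinner_diff_left cinner_scale_left x_def R_def)
    have "cinner v (\<phi> (s *s e)) = 0" using orth[OF vb cnj_ball[OF s]] by simp
    then have "cinner v v = 0"
      using vb unfolding v_def[THEN arg_cong[of _ _ "cinner v"]] by (simp add: cinner_diff_right cinner_scale_right)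
    then show ?thesis by (simp add: cinner_self_eq_0 v_def)
  qed

  have xy_eq: "cinner (\<phi> (s *s e)) (\<phi> (cnj t *s e)) = x s * y t / R" if "s \<in> ball 0 1" for s t
    by (simp add: on_line[OF that] cinner_scale_left y_def)
  have "\<exists>c. \<forall>z\<in>ball 0 1. deriv f z * (1 - c * z) = deriv f 0 * f z"
  proof (rule product_identity_imp_ode[of f x R y])
    show "deriv x 0 \<noteq> 0" using DERIV_imp_deriv[OF dx] k R0 by simp
    show "x s \<in> ball 0 1" if "s \<in> ball 0 1" for s
      unfolding x_def by (rule cinner_in_disc[OF phi[OF ball[OF that]] b_ball])
    show "isCont y 0" using dy by (rule DERIV_isCont)
    show "x s * y t / R \<in> ball 0 1" if "s \<in> ball 0 1" "t \<in> ball 0 1" for s t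
      unfolding xy_eq[OF that(1), symmetric]
      by (rule cinner_in_disc[OF phi[OF ball[OF that(1)]] phi[OF ball[OF cnj_ball[OF that(2)]]]])
    show "f (s * t) * f (y t) * f (x s) = f R * f (x s * y t / R)"
      if "s \<in> ball 0 1" "t \<in> ball 0 1" for s t
      using three_term[OF ball[OF cnj_ball[OF that(2)]] ball[OF that(1)]]
      unfolding xy_eq[OF that(1)]
      by (simp add: cinner_scale_left cinner_scale_right ee x_def y_def mult.commute[of s])
  qed (fact hf hx f0 a0 R_disc R0 fR x0 y0 yD)+
  then obtain c where c: "\<And>z. z \<in> ball 0 1 \<Longrightarrow> deriv f z * (1 - c * z) = deriv f 0 * f z"
    by blast
  have "c = 1"
    by (rule ode_parameter_eq_1[OF a0 c pos r k Rr y0 dy yr fy line])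
  then show ?thesis using c[OF z] by simp
qed

end

section \<open>Unitarily invariant spaces\<close>

lemma (in rkhs) nrm_ker_sq: "w \<in> X \<Longrightarrow> (nrm (ker w))\<^sup>2 = Re (K w w)"
  using arg_cong[OF ip_self[OF kernel_mem, of w], of Re] ip_ker_ker[of w w] by (simp del: of_real_power)

section \<open>Holomorphy along complex lines through the origin\<close>

locale ball_rkhs = rkhs "unit_ball :: (complex ^ 'd) set" H ip K
  for H :: "(complex ^ 'd \<Rightarrow> complex) set" and ip K +
  fixes f :: "complex \<Rightarrow> complex"
  assumes hf: "f holomorphic_on ball 0 1"
    and K_eq: "\<And>z w. z \<in> unit_ball \<Longrightarrow> w \<in> unit_ball \<Longrightarrow> K z w = f (cinner z w)"
begin

text \<open>Clear for kernel functions, whose restrictions are \<open>f (t * cinner e w)\<close>.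
  Norm convergence is uniform on compact discs because kernel norms are bounded there, so
  \<open>closed_subspace_eq\<close> applies.\<close>

lemma holomorphic_on_lines:
  assumes "g \<in> H" "norm e \<le> 1"
  shows "(\<lambda>t. g (t *s e)) holomorphic_on ball 0 1"
proof -
  define S where "S = {g \<in> H. \<forall>e. norm e \<le> 1 \<longrightarrow> (\<lambda>t. g (t *s e)) holomorphic_on ball 0 1}"
  have "S = H"
  proof (rule closed_subspace_eq)
    show "ker w \<in> S" if w: "w \<in> unit_ball" for w
    proof -
      have "(\<lambda>t. ker w (t *s e)) holomorphic_on ball 0 1" if e: "norm e \<le> 1" for e
      proof -
        have "(\<lambda>t. f (t * cinner e w)) holomorphic_on ball 0 1"
        proof (rule holomorphic_on_compose_gen[unfolded o_def, OF _ hf])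
          show "(\<lambda>t. t * cinner e w) holomorphic_on ball 0 1" by (intro holomorphic_intros)
          show "(\<lambda>t. t * cinner e w) ` ball 0 1 \<subseteq> ball 0 1"
            using cinner_in_disc[OF scale_in_unit_ball[OF _ e] w] by (auto simp: cinner_scale_left)
        qed
        then show ?thesis
          by (rule holomorphic_transform)
            (use scale_in_unit_ball[OF _ e] w in \<open>auto simp: kernel_fun_def K_eq cinner_scale_left\<close>)
      qed
      then show ?thesis using kernel_mem[OF w] by (simp add: S_def)
    qed
    show "h \<in> S" if FS: "\<And>n. F n \<in> S" and h: "h \<in> H"
      and lim: "(\<lambda>n. nrm (\<lambda>x. F n x - h x)) \<longlonglongrightarrow> 0" for F h
    proof -
      have FH: "\<And>n. F n \<in> H" using FS by (auto simp: S_def)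
      have "(\<lambda>t. h (t *s e)) holomorphic_on ball 0 1" if e: "norm e \<le> 1" for e
      proof (rule holomorphic_uniform_sequence)
        show "(\<lambda>t. F n (t *s e)) holomorphic_on ball 0 1" for n using FS e by (auto simp: S_def)
        fix x :: complex assume "x \<in> ball 0 1"
        then obtain d where d: "d > 0" "cball x d \<subseteq> ball 0 1"
          using open_contains_cball[of "ball 0 (1::real) :: complex set"] open_ball by blast
        let ?k = "\<lambda>t. K (t *s e) (t *s e)"
        \<comment> \<open>This function of \<open>t\<close> is the squared norm of the kernel
          function at \<open>t *s e\<close>, and continuity bounds it on the closed disc.\<close>
        have "continuous_on (cball x d) (\<lambda>t. f (t * cnj t * cinner e e))"
        proof (rule continuous_on_compose2[OF holomorphic_on_imp_continuous_on[OF hf]])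
          show "(\<lambda>t. t * cnj t * cinner e e) ` cball x d \<subseteq> ball 0 1"
          proof clarify
            fix t assume "t \<in> cball x d"
            then have "t *s e \<in> unit_ball" using d scale_in_unit_ball e by blast
            from cinner_in_disc[OF this this] show "t * cnj t * cinner e e \<in> ball 0 1"
              unfolding cinner_scale_left cinner_scale_right by (simp only: mult_ac)
          qed
        qed (intro continuous_intros)
        then have "compact ((\<lambda>t. f (t * cnj t * cinner e e)) ` cball x d)"
          by (intro compact_continuous_image) auto
        then have "bounded ((\<lambda>t. f (t * cnj t * cinner e e)) ` cball x d)"
          by (rule compact_imp_bounded)
        then obtain B where "\<forall>v \<in> (\<lambda>t. f (t * cnj t * cinner e e)) ` cball x d. cmod v \<le> B"
          unfolding bounded_iff by (elim exE)
        then have B: "\<And>t. t \<in> cball x d \<Longrightarrow> cmod (f (t * cnj t * cinner e e)) \<le> B" by blast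
        have B': "nrm (ker (t *s e)) \<le> sqrt B" if t: "t \<in> cball x d" for t
        proof -
          have te: "t *s e \<in> unit_ball" using t d scale_in_unit_ball e by blast
          have "(nrm (ker (t *s e)))\<^sup>2 = Re (f (t * cnj t * cinner e e))"
            using nrm_ker_sq[OF te] K_eq[OF te te]
            by (simp add: cinner_scale_left cinner_scale_right mult_ac)
          also have "\<dots> \<le> B" using B[OF t] complex_Re_le_cmod order_trans by blast
          finally show ?thesis by (rule real_le_rsqrt)
        qed
        have "uniform_limit (cball x d) (\<lambda>n t. F n (t *s e)) (\<lambda>t. h (t *s e)) sequentially"
        proof (rule uniform_limitI)
          fix \<epsilon> :: real assume "\<epsilon> > 0"
          have "(\<lambda>n. nrm (\<lambda>x. F n x - h x) * sqrt B) \<longlonglongrightarrow> 0"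
            using tendsto_mult_right[OF lim, of "sqrt B"] by simp
          then have "\<forall>\<^sub>F n in sequentially. nrm (\<lambda>x. F n x - h x) * sqrt B < \<epsilon>"
            using \<open>\<epsilon> > 0\<close> by (rule order_tendstoD)
          then show "\<forall>\<^sub>F n in sequentially. \<forall>t\<in>cball x d. dist (F n (t *s e)) (h (t *s e)) < \<epsilon>"
          proof (rule eventually_mono, intro ballI)
            fix n t assume n: "nrm (\<lambda>x. F n x - h x) * sqrt B < \<epsilon>" and t: "t \<in> cball x d"
            have te: "t *s e \<in> unit_ball" using t d scale_in_unit_ball e by blast
            have dH: "(\<lambda>x. F n x - h x) \<in> H" using FH h diff_mem by blast
            have "dist (F n (t *s e)) (h (t *s e)) \<le> nrm (\<lambda>x. F n x - h x) * nrm (ker (t *s e))"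
              using point_eval_le[OF dH te] by (simp add: dist_norm)
            also have "\<dots> \<le> nrm (\<lambda>x. F n x - h x) * sqrt B"
              by (intro mult_left_mono B' t nrm_nonneg dH)
            finally show "dist (F n (t *s e)) (h (t *s e)) < \<epsilon>" using n by simp
          qed
        qed
        then show "\<exists>d>0. cball x d \<subseteq> ball 0 1 \<and>
            uniform_limit (cball x d) (\<lambda>n t. F n (t *s e)) (\<lambda>t. h (t *s e)) sequentially"
          using d by blast
      qed simp
      then show ?thesis using h by (simp add: S_def)
    qed
  qed (auto simp: S_def zero_mem add_mem scale_mem intro!: holomorphic_intros)
  then show ?thesis using assms by (auto simp: S_def)
qed

text \<open>Applying the operator to kernel functions shows that
  \<open>\<delta> * f (cinner \<phi> w)\<close> is holomorphic on lines, and \<open>w = 0\<close>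
  gives \<open>\<delta>\<close> alone. Dividing and taking \<open>w\<close> to be a small multiple
  of \<open>p\<close>, the difference quotients of \<open>f\<close> at 0 converge uniformly to
  \<open>deriv f 0 * cinner \<phi> p\<close>.\<close>

lemma kernel_identity_holomorphic:
  assumes f0: "f 0 = 1" and a0: "deriv f 0 \<noteq> 0"
    and phi: "\<phi> \<in> unit_ball \<rightarrow> unit_ball"
    and W: "\<And>g. g \<in> H \<Longrightarrow> weighted_comp unit_ball \<delta> \<phi> g \<in> H"
    and nz: "\<And>z. z \<in> unit_ball \<Longrightarrow> \<delta> z \<noteq> 0"
    and e: "norm e \<le> 1"
  shows "(\<lambda>t. cinner (\<phi> (t *s e)) p) holomorphic_on ball 0 1"
proof -
  note te = scale_in_unit_ball[OF _ e]
  have hW: "(\<lambda>t. \<delta> (t *s e) * f (cinner (\<phi> (t *s e)) w)) holomorphic_on ball 0 1"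
    if w: "w \<in> unit_ball" for w
    by (rule holomorphic_transform[OF holomorphic_on_lines[OF W[OF kernel_mem[OF w]] e]])
      (use te phi w in \<open>auto simp: weighted_comp_def kernel_fun_def K_eq Pi_iff\<close>)
  have hd: "(\<lambda>t. \<delta> (t *s e)) holomorphic_on ball 0 1"
    using hW[of 0] f0 by simp
  \<comment> \<open>Small enough that \<open>ep n *s p\<close> lies in the ball for every
    \<open>n\<close>, including \<open>n = 0\<close>.\<close>
  define ep where "ep n = 1 / (real n + 1 + norm p)" for n
  have ep0: "ep n > 0" for n
    unfolding ep_def by (rule divide_pos_pos) (auto intro: add_pos_nonneg)
  have ep1: "ep n * norm p < 1" for n by (simp add: ep_def divide_less_eq add_pos_nonneg)
  have ep_lim: "(\<lambda>n. ep n * norm p) \<longlonglongrightarrow> 0"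
    unfolding ep_def by real_asymp
  define u where "u t = cinner (\<phi> (t *s e)) p" for t
  have u: "cmod (u t) \<le> norm p" if "t \<in> ball 0 1" for t
  proof -
    have "cmod (u t) \<le> norm (\<phi> (t *s e)) * norm p" unfolding u_def by (rule cinner_Cauchy_Schwarz)
    also have "\<dots> \<le> 1 * norm p" using phi te[OF that] by (intro mult_right_mono) (auto simp: less_imp_le Pi_iff)
    finally show ?thesis by simp
  qed
  define h where "h n t = (f (of_real (ep n) * u t) - 1) / of_real (ep n)" for n t
  have hh: "h n holomorphic_on ball 0 1" for n
  proof -
    let ?w = "complex_of_real (ep n) *s p"
    have w: "?w \<in> unit_ball" using ep1[of n] ep0[of n] by (simp add: norm_scale_vec)
    have "(\<lambda>t. (\<delta> (t *s e) * f (cinner (\<phi> (t *s e)) ?w) / \<delta> (t *s e) - 1) / of_real (ep n)) holomorphic_on ball 0 1"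
      using ep0[of n] by (intro holomorphic_intros hW[OF w] hd) (auto intro!: nz te)
    then show ?thesis
      by (rule holomorphic_transform) (use nz te in \<open>simp add: h_def u_def cinner_scale_right\<close>)
  qed
  have "(\<lambda>t. deriv f 0 * u t) holomorphic_on ball 0 1"
  proof (rule holomorphic_uniform_sequence[OF _ hh])
    have unif: "uniform_limit (ball 0 1) h (\<lambda>t. deriv f 0 * u t) sequentially"
    proof (rule uniform_limitI)
      fix \<epsilon> :: real assume eps: "\<epsilon> > 0"
      define \<eta> where "\<eta> = \<epsilon> / (norm p + 1)"
      have eta: "\<eta> > 0" using eps by (simp add: \<eta>_def add_nonneg_pos)
      have "(f has_derivative (\<lambda>h. deriv f 0 * h)) (at 0)"
        using holomorphic_derivI[OF hf, of 0] by (simp add: has_field_derivative_def)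
      then obtain d where d: "d > 0" "\<And>v. cmod v < d \<Longrightarrow> cmod (f v - 1 - deriv f 0 * v) \<le> \<eta> * cmod v"
        using eta f0 unfolding has_derivative_at_alt by (metis diff_zero)
      show "\<forall>\<^sub>F n in sequentially. \<forall>t\<in>ball 0 1. dist (h n t) (deriv f 0 * u t) < \<epsilon>"
      proof (rule eventually_mono[OF order_tendstoD(2)[OF ep_lim d(1)]], intro ballI)
        fix n t assume n: "ep n * norm p < d" and t: "t \<in> ball (0::complex) 1"
        let ?v = "of_real (ep n) * u t"
        have v: "cmod ?v \<le> ep n * norm p"
          using u[OF t] ep0[of n] by (simp add: norm_mult)
        have "dist (h n t) (deriv f 0 * u t) = cmod ((f ?v - 1 - deriv f 0 * ?v) / of_real (ep n))"
          using ep0[of n] by (simp add: h_def dist_norm field_simps)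
        also have "\<dots> \<le> \<eta> * cmod ?v / ep n"
          using d(2)[of ?v] v n ep0[of n] by (simp add: norm_divide divide_right_mono)
        also have "\<dots> = \<eta> * cmod (u t)" using ep0[of n] by (simp add: norm_mult)
        also have "\<dots> \<le> \<eta> * norm p" using u[OF t] eta by simp
        also have "\<dots> < \<eta> * (norm p + 1)" using eta by simp
        also have "\<dots> = \<epsilon>" by (simp add: \<eta>_def add_nonneg_eq_0_iff)
        finally show "dist (h n t) (deriv f 0 * u t) < \<epsilon>" .
      qed
    qed
    fix x :: complex assume "x \<in> ball 0 1"
    then obtain d where "d > 0" "cball x d \<subseteq> ball 0 1"
      using open_contains_cball[of "ball 0 (1::real) :: complex set"] open_ball by blast
    then show "\<exists>d>0. cball x d \<subseteq> ball 0 1 \<and> uniform_limit (cball x d) h (\<lambda>t. deriv f 0 * u t) sequentially"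
      using uniform_limit_on_subset[OF unif] by blast
  qed simp
  then have "(\<lambda>t. deriv f 0 * u t / deriv f 0) holomorphic_on ball 0 1"
    using a0 by (intro holomorphic_on_divide[OF _ holomorphic_on_const])
  then show ?thesis using a0 by (simp add: u_def)
qed

end

text \<open>The series is given only at inner products of points of the ball, but these fill the
  disc, so \<open>f\<close> is holomorphic there. Nonnegative coefficients and
  \<open>a 0 = 1\<close> make \<open>f\<close> at least 1 on the real segment.\<close>

lemma unitarily_invariant_space_kernel:
  fixes H :: "(complex ^ 'd \<Rightarrow> complex) set"
  assumes "unitarily_invariant_space H ip"
  obtains K f a where "ball_rkhs H ip K f" "f 0 = 1" "deriv f 0 = complex_of_real a" "a > 0"
    "\<And>u::real. 0 \<le> u \<Longrightarrow> u < 1 \<Longrightarrow> f (of_real u) \<noteq> 0"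
proof -
  obtain K and a :: "nat \<Rightarrow> real" where K: "rkhs unit_ball H ip K"
    and a: "a 0 = 1" "a 1 > 0" "\<And>n. n \<ge> 2 \<Longrightarrow> a n \<ge> 0"
    and sums: "\<And>z w. z \<in> unit_ball \<Longrightarrow> w \<in> unit_ball \<Longrightarrow> (\<lambda>n. of_real (a n) * cinner z w ^ n) sums K z w"
    using assms unfolding unitarily_invariant_space_def by blast
  define f where "f z = (\<Sum>n. complex_of_real (a n) * z ^ n)" for z
  have fs: "(\<lambda>n. of_real (a n) * z ^ n) sums f z" if z: "cmod z < 1" for z
  proof -
    \<comment> \<open>Strictly between \<open>cmod z\<close> and 1, so that \<open>z\<close> is the
      product of \<open>z / \<rho>\<close> and \<open>\<rho>\<close>, placed on the same axis inside
      the ball.\<close>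
    define \<rho> where "\<rho> = (1 + cmod z) / 2"
    have \<rho>: "cmod z < \<rho>" "0 < \<rho>" "\<rho> < 1" using z by (auto simp: \<rho>_def add_pos_nonneg)
    fix i :: 'd
    let ?z = "axis i (z / of_real \<rho>) :: complex ^ 'd" and ?w = "axis i (of_real \<rho>) :: complex ^ 'd"
    have "?z \<in> unit_ball" "?w \<in> unit_ball" using \<rho> by (simp_all add: norm_axis norm_divide)
    from sums[OF this] have "summable (\<lambda>n. of_real (a n) * z ^ n)"
      using \<rho> by (simp add: cinner_axis_axis sums_iff)
    then show ?thesis unfolding f_def by (rule summable_sums)
  qed
  have hf: "f holomorphic_on ball 0 1"
    by (rule power_series_holomorphic) (use fs in simp)
  have "f 0 = 1" using fs[of 0] a(1) powser_sums_zero_iff[of "\<lambda>n. of_real (a n)" "f 0"] by simp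
  moreover have "deriv f 0 = of_real (a 1)"
  proof -
    have "(f has_field_derivative deriv f 0) (at 0)" using holomorphic_derivI[OF hf] by simp
    from termdiffs_sums_strong[OF fs this] show ?thesis
      using powser_sums_zero_iff[of "diffs (\<lambda>n. complex_of_real (a n))" "deriv f 0"]
      by (simp add: diffs_def)
  qed
  moreover have "f (of_real u) \<noteq> 0" if u: "0 \<le> u" "u < 1" for u :: real
  proof -
    have s: "(\<lambda>n. a n * u ^ n) sums Re (f (of_real u))"
      using sums_Re[OF fs[of "of_real u"]] u by simp
    have "a n \<ge> 0" for n using a by (cases "n = 0 \<or> n = 1") (auto intro: less_imp_le)
    then have "sum (\<lambda>n. a n * u ^ n) {0} \<le> (\<Sum>n. a n * u ^ n)"
      using s u by (intro sum_le_suminf) (auto simp: sums_iff)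
    then have "Re (f (of_real u)) \<ge> 1" using s a(1) by (simp add: sums_iff)
    then show ?thesis by auto
  qed
  moreover have "ball_rkhs H ip K f"
  proof -
    have "K z w = f (cinner z w)" if "z \<in> unit_ball" "w \<in> unit_ball" for z w
      using sums_unique2[OF sums[OF that] fs] cinner_in_disc[OF that] by simp
    then show ?thesis using K hf by (simp add: ball_rkhs_def ball_rkhs_axioms_def)
  qed
  ultimately show ?thesis using that[of K f "a 1"] a(2) by blast
qed

section \<open>Characterization of unitary and co-isometric weighted composition operators\<close>

theorem theorem1p2:
  fixes \<phi> :: "complex ^ 'd \<Rightarrow> complex ^ 'd"
    and \<delta> :: "complex ^ 'd \<Rightarrow> complex"
    and H :: "(complex ^ 'd \<Rightarrow> complex) set"
    and ip :: "(complex ^ 'd \<Rightarrow> complex) \<Rightarrow> (complex ^ 'd \<Rightarrow> complex) \<Rightarrow> complex"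
  assumes "\<phi> \<in> unit_ball \<rightarrow> unit_ball"
    and "unitarily_invariant_space H ip"
    and "\<And>\<gamma>. \<gamma> > 0 \<Longrightarrow> \<not> rkhs unit_ball H ip (gamma_kernel \<gamma>)"
  shows "(unitary_operator H ip (weighted_comp unit_ball \<delta> \<phi>) \<longleftrightarrow>
            coisometric_operator H ip (weighted_comp unit_ball \<delta> \<phi>)) \<and>
         (coisometric_operator H ip (weighted_comp unit_ball \<delta> \<phi>) \<longleftrightarrow>
            (\<exists>U c. unitary_matrix U \<and> cmod c = 1 \<and>
               (\<forall>z\<in>unit_ball. \<phi> z = U *v z) \<and> (\<forall>z\<in>unit_ball. \<delta> z = c)))"
proof -
  let ?W = "weighted_comp unit_ball \<delta> \<phi>"
  let ?rot = "\<exists>U c. unitary_matrix U \<and> cmod c = 1 \<and>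
               (\<forall>z\<in>unit_ball. \<phi> z = U *v z) \<and> (\<forall>z\<in>unit_ball. \<delta> z = c)"
  obtain K f a where K: "ball_rkhs H ip K f" and f0: "f 0 = 1"
    and a: "deriv f 0 = complex_of_real a" "a > 0"
    and pos: "\<And>u::real. 0 \<le> u \<Longrightarrow> u < 1 \<Longrightarrow> f (of_real u) \<noteq> 0"
    using unitarily_invariant_space_kernel[OF assms(2)] by blast
  interpret ball_rkhs H ip K f by (rule K)
  have a0: "deriv f 0 \<noteq> 0" using a by simp

  \<comment> \<open>The unitary and the co-isometric case share these two consequences, so one
    argument serves both.\<close>
  have rot: ?rot
    if W: "\<And>g. g \<in> H \<Longrightarrow> ?W g \<in> H"
      and Keq: "\<And>z w. z \<in> unit_ball \<Longrightarrow> w \<in> unit_ball \<Longrightarrow> K z w = \<delta> z * cnj (\<delta> w) * K (\<phi> z) (\<phi> w)"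
  proof -
    have phi: "\<phi> z \<in> unit_ball" if "z \<in> unit_ball" for z using assms(1) that by blast
    then have phi': "norm (\<phi> z) < 1" if "norm z < 1" for z using that by simp
    have keq: "f (cinner z w) = \<delta> z * cnj (\<delta> w) * f (cinner (\<phi> z) (\<phi> w))"
      if "z \<in> unit_ball" "w \<in> unit_ball" for z w
      using Keq[OF that] K_eq[OF that] K_eq[OF phi phi, OF that] by simp
    have nz: "\<delta> z \<noteq> 0" if "z \<in> unit_ball" for z
      using keq[OF that, of 0] f0 by auto
    interpret kernel_identity f \<phi> \<delta>
      by unfold_locales
        (auto simp: hf f0 a0 pos intro!: kernel_identity_holomorphic[OF f0 a0 assms(1) W nz] keq phi')
    \<comment> \<open>Otherwise \<open>f z = (1 - z) powr (- a)\<close>, and the space has the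
      excluded kernel with parameter \<open>a = deriv f 0 > 0\<close>.\<close>
    have "b = 0"
    proof (rule ccontr)
      assume b: "b \<noteq> 0"
      have f_eq: "f z = (1 - z) powr (- of_real a)" if "z \<in> ball 0 1" for z
        using log_derivative_pole_powr[OF hf f0 ode_if_not_fixes_0[OF b] that] a by simp
      have "kernel_fun unit_ball (gamma_kernel a) w = kernel_fun unit_ball K w" if "w \<in> unit_ball" for w
        using that cinner_in_disc[OF _ that]
        by (auto simp: kernel_fun_def gamma_kernel_def K_eq f_eq fun_eq_iff)
      then have "rkhs unit_ball H ip (gamma_kernel a)"
        using kernel_mem reproducing by unfold_locales auto
      then show False using assms(3)[OF a(2)] by blast
    qed
    then show ?thesis using unitary_if_fixes_0 by metis
  qed

  have "?rot" if "unitary_operator H ip ?W"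
    using that unitary_kernel_eq[OF assms(1) that]
    by (intro rot) (auto simp: unitary_operator_def bounded_operator_def)
  moreover have "?rot" if "coisometric_operator H ip ?W"
    using that coisometric_kernel_eq[OF assms(1) that]
    by (intro rot) (auto simp: coisometric_operator_def bounded_operator_def)
  \<comment> \<open>The inverse of \<open>\<phi>\<close> is the adjoint matrix, and \<open>K\<close>
    is invariant because it depends only on the inner product.\<close>
  moreover have "unitary_operator H ip ?W \<and> coisometric_operator H ip ?W" if rot: ?rot
  proof -
    obtain U c where U: "unitary_matrix U" and c: "cmod c = 1"
      and phi: "\<And>z. z \<in> unit_ball \<Longrightarrow> \<phi> z = U *v z" and delta: "\<And>z. z \<in> unit_ball \<Longrightarrow> \<delta> z = c"
      using rot by blast
    let ?psi = "\<lambda>z. adj_matrix U *v z"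
    have psi: "?psi z \<in> unit_ball" if "z \<in> unit_ball" for z
      using that norm_eq_if_cinner[OF unitary_matrix_cinner(2)[OF U, of z z]] by simp
    have inv: "adj_matrix U *v (U *v v) = v" "U *v (adj_matrix U *v v) = v" for v
      using U by (simp_all add: unitary_matrix_iff matrix_vector_mul_assoc)
    have Kinv: "K (\<phi> z) (\<phi> w) = K z w" if "z \<in> unit_ball" "w \<in> unit_ball" for z w
      using that assms(1) K_eq[of "\<phi> z" "\<phi> w"] K_eq[OF that] unitary_matrix_cinner(1)[OF U]
      by (simp add: phi Pi_iff)
    have *: "?psi \<in> unit_ball \<rightarrow> unit_ball" "\<And>w. w \<in> unit_ball \<Longrightarrow> \<phi> (?psi w) = w"
      "\<And>w. w \<in> unit_ball \<Longrightarrow> ?psi (\<phi> w) = w"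
      using psi by (simp_all add: phi inv)
    show ?thesis
      by (intro conjI; rule weighted_comp_unitary[OF assms(1) * Kinv c delta]; assumption)
  qed
  ultimately show ?thesis by blast
qed

end
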